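(* Let $g(t)=A(t)f^1\otimes f^1+B(t)f^2\otimes f^2+C(t)f^3\otimes f^3$ be the solution of the positive cross curvature flow on $E(2)$ with given initial data $A_0,B_0,C_0>0$. - If $A_0=B_0$, then $g(t)=g(0)=A_0f^1\otimes f^1+A_0f^2\otimes f^2+C_0f^3\otimes f^3$ for all $t$. - If $A_0>B_0$, then there exists a finite time $T>0$ such that the (maximal) solution $g(t)$ exists on $[0,T)$ and, as $t\to T$, $$A\sim\eta_1(T-t)^{-1/14},\quad B\sim\eta_2(T-t)^{3/14},\quad C\sim\eta_3(T-t)^{3/14}$$ for some constants $\eta_1,\eta_2,\eta_3\in(0,\infty)$.
   Context: $(f_i)$ is a left-invariant frame on (the universal cover of) $E(2)$, the group of Euclidean motions of the plane, with $[f_2,f_3]=2f_1$, $[f_3,f_1]=2f_2$, $[f_1,f_2]=0$; $(f^i)$ is the dual frame. The positive cross curvature flow is $\partial_tg=2h$, where $h$ is the cross curvature tensor (diagonal in an orthonormal frame diagonalizing Ricci, with $h_{ii}=k_jk_l$, $k_i$ being the sectional curvature of the plane orthogonal to the $i$-th vector). It is equivalent to the ODE system, for positive functions $A,B,C$ with $(A,B,C)(0)=(A_0,B_0,C_0)$, $$\frac{dA}{dt}=\frac{2AYZ}{(ABC)^2},\quad\frac{dB}{dt}=\frac{2BZX}{(ABC)^2},\quad\frac{dC}{dt}=\frac{2CXY}{(ABC)^2},$$ $$X=(A-B)(3A+B),\quad Y=(B-A)(3B+A),\quad Z=-(A-B)^2.$$ The notation $u\sim v$ means $u/v\to1$. 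*)

theory Defs
  imports "HOL-Analysis.Analysis" "HOL-Library.Landau_Symbols"
begin

unbundle asymp_equiv_syntax

text \<open>
  Left-invariant vector fields on the universal cover of \<open>E(2)\<close> are identified with their
  coefficient vectors in \<open>real^3\<close> relative to the left-invariant frame \<open>(f\<^sub>1, f\<^sub>2, f\<^sub>3)\<close>, so
  \<open>f\<^sub>i = axis i 1\<close> and the dual frame is \<open>f\<^sup>i v = v $ i\<close>.  Left-invariant tensor fields are
  multilinear maps on \<open>real^3\<close>.
\<close>

definition e2_bracket :: "real^3 \<Rightarrow> real^3 \<Rightarrow> real^3" where
  "e2_bracket u v =
     vector [2 * (u $ 2 * v $ 3 - u $ 3 * v $ 2), 2 * (u $ 3 * v $ 1 - u $ 1 * v $ 3), 0]"

lemma e2_bracket_frame: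
  "e2_bracket (axis 2 1) (axis 3 1) = 2 *\<^sub>R axis 1 1"
  "e2_bracket (axis 3 1) (axis 1 1) = 2 *\<^sub>R axis 2 1"
  "e2_bracket (axis 1 1) (axis 2 1) = 0"
  by (simp_all add: e2_bracket_def vec_eq_iff forall_3 axis_def)

type_synonym tensor2 = "real^3 \<Rightarrow> real^3 \<Rightarrow> real"

definition riemannian_metric :: "tensor2 \<Rightarrow> bool" where
  "riemannian_metric g \<longleftrightarrow>
     bilinear g \<and> (\<forall>u v. g u v = g v u) \<and> (\<forall>v. v \<noteq> 0 \<longrightarrow> g v v > 0)"

definition diag_metric :: "real \<Rightarrow> real \<Rightarrow> real \<Rightarrow> tensor2" where
  "diag_metric a b c u v = a * (u $ 1 * v $ 1) + b * (u $ 2 * v $ 2) + c * (u $ 3 * v $ 3)"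

text \<open>
  In the metric condition the term \<open>u (g v w)\<close> is absent, since \<open>g v w\<close> is constant for
  left-invariant fields.
\<close>

definition levi_civita :: "tensor2 \<Rightarrow> real^3 \<Rightarrow> real^3 \<Rightarrow> real^3" where
  "levi_civita g = (THE D. bilinear D \<and>
     (\<forall>u v. D u v - D v u = e2_bracket u v) \<and>
     (\<forall>u v w. g (D u v) w + g v (D u w) = 0))"

definition riemann :: "tensor2 \<Rightarrow> real^3 \<Rightarrow> real^3 \<Rightarrow> real^3 \<Rightarrow> real^3" where
  "riemann g u v w =
     levi_civita g u (levi_civita g v w) - levi_civita g v (levi_civita g u w)
       - levi_civita g (e2_bracket u v) w"

definition ricci :: "tensor2 \<Rightarrow> tensor2" where
  "ricci g u v = trace (matrix (\<lambda>w. riemann g w u v))"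

definition sectional :: "tensor2 \<Rightarrow> tensor2" where
  "sectional g u v = g (riemann g u v v) u / (g u u * g v v - (g u v)\<^sup>2)"

definition orthonormal_frame :: "tensor2 \<Rightarrow> (3 \<Rightarrow> real^3) \<Rightarrow> bool" where
  "orthonormal_frame g e \<longleftrightarrow> (\<forall>i j. g (e i) (e j) = (if i = j then 1 else 0))"

text \<open>
  The value \<open>k i\<close> is the sectional curvature of the plane orthogonal to \<open>e i\<close>.  The tensor \<open>h\<close>
  does not depend on the choice of the Ricci-diagonalizing frame.
\<close>

definition is_cross_curvature :: "tensor2 \<Rightarrow> tensor2 \<Rightarrow> bool" where
  "is_cross_curvature g h \<longleftrightarrow> bilinear h \<and>
     (\<exists>e k. orthonormal_frame g e \<and>
        (\<forall>i j. i \<noteq> j \<longrightarrow> ricci g (e i) (e j) = 0) \<and>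
        (\<forall>i j l. distinct [i, j, l] \<longrightarrow> k i = sectional g (e j) (e l)) \<and>
        (\<forall>i j. i \<noteq> j \<longrightarrow> h (e i) (e j) = 0) \<and>
        (\<forall>i j l. distinct [i, j, l] \<longrightarrow> h (e i) (e i) = k j * k l))"

text \<open>
  Positive cross curvature flow on \<open>[0, T)\<close>, where \<open>T\<close> may be infinite.  The values of \<open>g\<close>
  outside \<open>[0, T)\<close> are irrelevant; the derivative is one-sided at time \<open>0\<close>.
\<close>

definition pxcf_solution :: "ereal \<Rightarrow> (real \<Rightarrow> tensor2) \<Rightarrow> bool" where
  "pxcf_solution T g \<longleftrightarrow> T > 0 \<and>
     (\<forall>t\<ge>0. ereal t < T \<longrightarrow> riemannian_metric (g t) \<and>
        (\<exists>h. is_cross_curvature (g t) h \<and>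
           (\<forall>u v. ((\<lambda>s. g s u v) has_real_derivative 2 * h u v) (at t within {0..}))))"

definition pxcf_maximal_solution :: "ereal \<Rightarrow> (real \<Rightarrow> tensor2) \<Rightarrow> bool" where
  "pxcf_maximal_solution T g \<longleftrightarrow> pxcf_solution T g \<and>
     \<not> (\<exists>S g'. S > T \<and> pxcf_solution S g' \<and> (\<forall>t\<ge>0. ereal t < T \<longrightarrow> g' t = g t))"

text \<open>
  \<open>g(t) = A(t) f\<^sup>1 \<otimes> f\<^sup>1 + B(t) f\<^sup>2 \<otimes> f\<^sup>2 + C(t) f\<^sup>3 \<otimes> f\<^sup>3\<close> is a maximal solution on \<open>[0, T)\<close> with
  the initial data \<open>a, b, c\<close>.
\<close>

definition diag_pxcf_from ::
  "real \<Rightarrow> real \<Rightarrow> real \<Rightarrow> ereal \<Rightarrow> (real \<Rightarrow> real) \<Rightarrow> (real \<Rightarrow> real) \<Rightarrow> (real \<Rightarrow> real) \<Rightarrow> bool" where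
  "diag_pxcf_from a b c T A B C \<longleftrightarrow>
     pxcf_maximal_solution T (\<lambda>t. diag_metric (A t) (B t) (C t)) \<and>
     A 0 = a \<and> B 0 = b \<and> C 0 = c"

end

theory Submission
  imports Defs
begin

text \<open>
  Along a diagonal solution both \<open>AB(A + B)\<^sup>2\<close> and \<open>C\<^sup>2(A - B)\<^sup>4/(AB)\<close> are constant.  If
  \<open>A\<^sub>0 = B\<^sub>0\<close>, the second constant is \<open>0\<close>, so \<open>A = B\<close> persists and nothing moves.  If
  \<open>A\<^sub>0 > B\<^sub>0\<close>, write the constants as \<open>n\<^sup>2\<close> and \<open>K\<close>; they express \<open>A, B, C\<close> through
  \<open>u = sqrt (B/A) \<in> (0, 1)\<close>, and the flow becomes the scalar equation
  \<open>2u\<^sup>6/(1 - u\<^sup>2)\<^sup>7 u' = -8n/K\<close>.  Integrating, \<open>u\<close> decreases to \<open>0\<close> at a finite time \<open>T\<close>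
  with \<open>u\<^sup>7\<close> asymptotic to a multiple of \<open>T - t\<close>, whereas \<open>A, B, C\<close> behave like constant
  multiples of \<open>u\<^bsup>-1/2\<^esup>, u\<^bsup>3/2\<^esup>, u\<^bsup>3/2\<^esup>\<close>.
\<close>

section \<open>Curvature of diagonal left-invariant metrics\<close>

text \<open>The Koszul formula for \<open>diag_metric a b c\<close>, solved for each component by
  pairing with the frame vectors.\<close>

definition e2_connection :: "real \<Rightarrow> real \<Rightarrow> real \<Rightarrow> real^3 \<Rightarrow> real^3 \<Rightarrow> real^3" where
  "e2_connection a b c u v = vector
     [((a - b) * (u $ 2 * v $ 3) - (a + b) * (u $ 3 * v $ 2)) / a,
      ((a - b) * (u $ 1 * v $ 3) + (a + b) * (u $ 3 * v $ 1)) / b,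
      (b - a) * (u $ 1 * v $ 2 + u $ 2 * v $ 1) / c]"

lemma bilinear_diag_metric: "bilinear (diag_metric a b c)"
  by (auto simp: bilinear_def diag_metric_def algebra_simps intro!: linearI)

lemma diag_metric_axis [simp]:
  "diag_metric a b c u (axis 1 1) = a * u $ 1"
  "diag_metric a b c u (axis 2 1) = b * u $ 2"
  "diag_metric a b c u (axis 3 1) = c * u $ 3"
  by (simp_all add: diag_metric_def axis_def)

lemma diag_metric_sym: "diag_metric a b c u v = diag_metric a b c v u"
  by (simp add: diag_metric_def mult.commute)

lemma riemannian_diag_metric_iff:
  "riemannian_metric (diag_metric a b c) \<longleftrightarrow> a > 0 \<and> b > 0 \<and> c > 0"
proof
  assume g: "riemannian_metric (diag_metric a b c)"
  have "diag_metric a b c (axis i 1) (axis i 1) > 0" for i :: 3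
    using g by (auto simp: riemannian_metric_def)
  from this[of 1] this[of 2] this[of 3] show "a > 0 \<and> b > 0 \<and> c > 0"
    by simp
next
  assume pos: "a > 0 \<and> b > 0 \<and> c > 0"
  have "diag_metric a b c v v > 0" if "v \<noteq> 0" for v
  proof -
    have *: "a * (v $ 1 * v $ 1) \<ge> 0" "b * (v $ 2 * v $ 2) \<ge> 0" "c * (v $ 3 * v $ 3) \<ge> 0"
      using pos by auto
    have "v $ 1 \<noteq> 0 \<or> v $ 2 \<noteq> 0 \<or> v $ 3 \<noteq> 0"
      using that by (auto simp: vec_eq_iff forall_3)
    then have "a * (v $ 1 * v $ 1) > 0 \<or> b * (v $ 2 * v $ 2) > 0 \<or> c * (v $ 3 * v $ 3) > 0"
      using pos by (auto simp: zero_less_mult_iff linorder_neq_iff)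
    then show ?thesis
      unfolding diag_metric_def using * by linarith
  qed
  then show "riemannian_metric (diag_metric a b c)"
    by (simp add: riemannian_metric_def bilinear_diag_metric diag_metric_sym)
qed

section \<open>Orthonormal triples and cross products in three-space\<close>

lemma third_index: "i \<noteq> j \<Longrightarrow> \<exists>l :: 3. distinct [i, j, l]"
proof -
  have "(\<exists>l :: 3. P l) \<longleftrightarrow> P 1 \<or> P 2 \<or> P 3" for P
    by (metis exhaust_3)
  then have "\<forall>i j. i \<noteq> j \<longrightarrow> (\<exists>l :: 3. distinct [i, j, l])"
    by (simp add: forall_3)
  then show "i \<noteq> j \<Longrightarrow> \<exists>l :: 3. distinct [i, j, l]"
    by blast
qed

text \<open>Both \<open>x\<close> and \<open>w\<close> are orthogonal to \<open>y\<close> and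
  \<open>z\<close>, so by the triple product expansion each is a multiple of the unit vector
  \<open>cross3 y z\<close>. Hence \<open>w \<bullet> x\<close> is the product of the two
  coefficients; it vanishes while the coefficient of \<open>x\<close> does not.\<close>

lemma orthonormal_complement:
  fixes x y z w :: "real^3"
  assumes "x \<bullet> x = 1" "y \<bullet> x = 0" "z \<bullet> x = 0" "y \<bullet> y = 1" "z \<bullet> y = 0" "z \<bullet> z = 1"
    and w: "w \<bullet> x = 0" "w \<bullet> y = 0" "w \<bullet> z = 0"
  shows "w = 0"
proof -
  have 1: "cross3 x (cross3 y z) = 0"
    using assms by (simp add: Lagrange inner_commute)
  have 2: "cross3 w (cross3 y z) = 0"
    using assms by (simp add: Lagrange inner_commute)
  have yz: "cross3 y z \<bullet> cross3 y z = 1"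
    using assms by (simp add: dot_cross inner_commute)
  have "0 = cross3 (cross3 y z) (cross3 w (cross3 y z))"
    by (simp add: 2)
  then have w: "w = (cross3 y z \<bullet> w) *\<^sub>R cross3 y z"
    by (simp add: Lagrange[of "cross3 y z" w "cross3 y z"] yz)
  have "0 = cross3 (cross3 y z) (cross3 x (cross3 y z))"
    by (simp add: 1)
  then have x: "x = (cross3 y z \<bullet> x) *\<^sub>R cross3 y z"
    by (simp add: Lagrange[of "cross3 y z" x "cross3 y z"] yz)
  have "w \<bullet> x = (cross3 y z \<bullet> w) * (cross3 y z \<bullet> x)"
    by (metis (no_types) inner_commute inner_scaleR_left w)
  moreover have "cross3 y z \<bullet> x \<noteq> 0"
    using x assms(1) by force
  ultimately show ?thesis
    using assms(7) w by auto
qed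

text \<open>The scalar \<open>r\<close> is the triple product of the frame, its orientation sign;
  cyclic invariance gives the same \<open>r\<close> in both equations. The Ricci-diagonalizing
  frames carry no orientation, but \<open>r\<close> enters later only through
  \<open>r * r\<close>.\<close>

lemma orthonormal_cross:
  fixes x y z :: "real^3"
  assumes "x \<bullet> x = 1" "y \<bullet> x = 0" "z \<bullet> x = 0" "y \<bullet> y = 1" "z \<bullet> y = 0" "z \<bullet> z = 1"
  shows "\<exists>r. r * r = 1 \<and> x = r *\<^sub>R cross3 y z \<and> y = r *\<^sub>R cross3 z x"
proof -
  define r where "r = x \<bullet> cross3 y z"
  have r': "r = y \<bullet> cross3 z x"
    by (simp add: r_def cross3_simps)
  have yz: "cross3 y z \<bullet> cross3 y z = 1" "cross3 z x \<bullet> cross3 z x = 1"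
    using assms by (simp_all add: dot_cross inner_commute)
  have "0 = cross3 (cross3 y z) (cross3 x (cross3 y z))"
    using assms by (simp add: Lagrange inner_commute)
  then have x: "x = r *\<^sub>R cross3 y z"
    by (simp add: Lagrange[of "cross3 y z" x "cross3 y z"] yz r_def inner_commute)
  have "0 = cross3 (cross3 z x) (cross3 y (cross3 z x))"
    using assms by (simp add: Lagrange inner_commute)
  then have y: "y = r *\<^sub>R cross3 z x"
    by (simp add: Lagrange[of "cross3 z x" y "cross3 z x"] yz r' inner_commute)
  have "r * r = (r *\<^sub>R cross3 y z) \<bullet> (r *\<^sub>R cross3 y z)"
    by (simp add: yz)
  also have "\<dots> = 1"
    using assms(1) by (simp flip: x)
  finally show ?thesis
    using x y by blast
qed

text \<open>In the notation of the paper these are \<open>-X/(ABC)\<close>, \<open>-Y/(ABC)\<close> and \<open>-Z/(ABC)\<close>.\<close>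

definition sec1 :: "real \<Rightarrow> real \<Rightarrow> real \<Rightarrow> real" where
  "sec1 a b c = - ((a - b) * (3 * a + b)) / (a * b * c)"

definition sec2 :: "real \<Rightarrow> real \<Rightarrow> real \<Rightarrow> real" where
  "sec2 a b c = - ((b - a) * (3 * b + a)) / (a * b * c)"

definition sec3 :: "real \<Rightarrow> real \<Rightarrow> real \<Rightarrow> real" where
  "sec3 a b c = (a - b)\<^sup>2 / (a * b * c)"

definition cross_curvature_diag :: "real \<Rightarrow> real \<Rightarrow> real \<Rightarrow> tensor2" where
  "cross_curvature_diag a b c = diag_metric (a * (sec2 a b c * sec3 a b c))
     (b * (sec1 a b c * sec3 a b c)) (c * (sec1 a b c * sec2 a b c))"

context
  fixes a b c :: real
  assumes pos: "a > 0" "b > 0" "c > 0"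
begin

text \<open>The candidate is checked directly. Uniqueness is the Koszul argument: torsion-freeness
  and metric compatibility determine every pairing of the connection with a third vector, and
  pairing with the frame vectors recovers the components.\<close>

lemma levi_civita_diag: "levi_civita (diag_metric a b c) = e2_connection a b c"
  unfolding levi_civita_def
proof (rule the_equality)
  let ?g = "diag_metric a b c" and ?D = "e2_connection a b c"
  have "bilinear ?D"
    using pos by (auto simp: bilinear_def e2_connection_def vec_eq_iff forall_3
        algebra_simps add_divide_distrib diff_divide_distrib intro!: linearI)
  moreover have "?D u v - ?D v u = e2_bracket u v" for u v
    using pos by (simp add: e2_connection_def e2_bracket_def vec_eq_iff forall_3 field_simps)
  moreover have "?g (?D u v) w + ?g v (?D u w) = 0" for u v w
    using pos by (simp add: e2_connection_def diag_metric_def field_simps)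
  ultimately show lc: "bilinear ?D \<and> (\<forall>u v. ?D u v - ?D v u = e2_bracket u v) \<and>
      (\<forall>u v w. ?g (?D u v) w + ?g v (?D u w) = 0)"
    by blast
  fix D
  assume D: "bilinear D \<and> (\<forall>u v. D u v - D v u = e2_bracket u v) \<and>
      (\<forall>u v w. ?g (D u v) w + ?g v (D u w) = 0)"
  have koszul: "2 * ?g (E u v) w
      = ?g (e2_bracket u v) w - ?g (e2_bracket v w) u + ?g (e2_bracket w u) v"
    if E: "\<And>u v. E u v - E v u = e2_bracket u v"
      "\<And>u v w. ?g (E u v) w + ?g v (E u w) = 0" for E u v w
  proof -
    have diff: "?g (x - y) z = ?g x z - ?g y z" for x y z
      by (simp add: diag_metric_def algebra_simps)
    show ?thesis
      unfolding E(1)[symmetric] diff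
      using E(2)[of u v w] E(2)[of v w u] E(2)[of w u v]
      by (simp add: diag_metric_sym)
  qed
  show "D = ?D"
  proof (intro ext)
    fix u v
    have "?g (D u v) w = ?g (?D u v) w" for w
      using koszul[of D u v w] koszul[of ?D u v w] D lc by simp
    from this[of "axis 1 1"] this[of "axis 2 1"] this[of "axis 3 1"] show "D u v = ?D u v"
      using pos by (simp add: vec_eq_iff forall_3)
  qed
qed

text \<open>The squared differences are the components of u x v, so the curvature is a diagonal
  quadratic form on bivectors. On the plane of two frame vectors only one term survives, which
  identifies \<open>sec1\<close>, \<open>sec2\<close>, \<open>sec3\<close> as the curvatures of the
  planes orthogonal to the frame vectors.\<close>

lemma curvature_form:
  "diag_metric a b c (riemann (diag_metric a b c) u v v) u =
     sec1 a b c * (b * c) * (u $ 2 * v $ 3 - u $ 3 * v $ 2)\<^sup>2 +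
     sec2 a b c * (a * c) * (u $ 3 * v $ 1 - u $ 1 * v $ 3)\<^sup>2 +
     sec3 a b c * (a * b) * (u $ 1 * v $ 2 - u $ 2 * v $ 1)\<^sup>2"
  unfolding riemann_def levi_civita_diag
  using pos by (simp add: e2_connection_def e2_bracket_def diag_metric_def sec1_def sec2_def
      sec3_def) (simp add: divide_simps, simp add: algebra_simps power2_eq_square)

lemma ricci_diag:
  "ricci (diag_metric a b c) u v =
     (sec2 a b c + sec3 a b c) * a * (u $ 1 * v $ 1) +
     (sec1 a b c + sec3 a b c) * b * (u $ 2 * v $ 2) +
     (sec1 a b c + sec2 a b c) * c * (u $ 3 * v $ 3)"
  unfolding ricci_def riemann_def levi_civita_diag trace_def matrix_def
  using pos by (simp add: sum_3 e2_connection_def e2_bracket_def axis_def sec1_def sec2_def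
      sec3_def) (simp add: divide_simps, simp add: algebra_simps power2_eq_square)

text \<open>
  The plane orthogonal to \<open>e\<^sub>i\<close> has curvature \<open>Q e\<^sub>i e\<^sub>i\<close> for a quadratic form \<open>Q\<close>, and \<open>Ric\<close> is
  diagonal in \<open>e\<close> exactly if \<open>Q\<close> is.  As \<open>e\<^sub>i\<close> is \<open>e\<^sub>j \<times> e\<^sub>l\<close> up to sign, the Binet-Cauchy
  identity shows that the adjugate form \<open>H\<close> of \<open>Q\<close> takes the values prescribed for the cross
  curvature on every such frame.
\<close>

lemma is_cross_curvature_diag_iff:
  "is_cross_curvature (diag_metric a b c) h \<longleftrightarrow> h = cross_curvature_diag a b c"
proof -
  define k1 k2 k3 where "k1 = sec1 a b c" and "k2 = sec2 a b c" and "k3 = sec3 a b c"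
  \<comment> \<open>\<open>p\<close> is an isometry from \<open>?g\<close> to the Euclidean inner
    product. It makes \<open>cross3\<close> yield normals of planes and absorbs the factors
    \<open>b * c\<close>, \<open>a * c\<close>, \<open>a * b\<close> of the curvature form.\<close>
  define p :: "real^3 \<Rightarrow> real^3" where
    "p u = vector [sqrt a * u $ 1, sqrt b * u $ 2, sqrt c * u $ 3]" for u
  define Q where "Q = diag_metric k1 k2 k3"
  define H where "H = diag_metric (k2 * k3) (k1 * k3) (k1 * k2)"
  let ?g = "diag_metric a b c"
  have sq: "sqrt a * (sqrt a * x) = a * x" "sqrt b * (sqrt b * x) = b * x"
    "sqrt c * (sqrt c * x) = c * x" for x
    using pos by (simp_all flip: mult.assoc)
  have gp: "p u \<bullet> p v = ?g u v" for u v
    by (simp add: p_def inner_vec_def sum_3 diag_metric_def algebra_simps sq)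
  have Hp: "H (p u) (p v) = cross_curvature_diag a b c u v" for u v
    by (simp add: H_def p_def cross_curvature_diag_def diag_metric_def k1_def k2_def k3_def
        algebra_simps sq)
  have curv: "?g (riemann ?g u v v) u = Q (cross3 (p u) (p v)) (cross3 (p u) (p v))" for u v
    unfolding curvature_form
    by (simp add: Q_def p_def cross_components diag_metric_def power2_eq_square k1_def k2_def
        k3_def algebra_simps sq)
  \<comment> \<open>The Ricci curvature of a direction adds the curvatures of two orthogonal planes
    through it, which is the trace of \<open>Q\<close> minus its value there. On an orthonormal
    frame the off-diagonal entries are therefore those of \<open>- Q\<close>.\<close>
  have ric: "ricci ?g u v = (k1 + k2 + k3) * ?g u v - Q (p u) (p v)" for u v
    unfolding ricci_diag
    by (simp add: Q_def p_def diag_metric_def k1_def k2_def k3_def algebra_simps sq)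
  have binet: "H (cross3 x y) (cross3 z w) = Q x z * Q y w - Q x w * Q y z" for x y z w
    by (simp add: H_def Q_def cross_components diag_metric_def algebra_simps)
  have scale: "H (r *\<^sub>R x) (s *\<^sub>R y) = r * s * H x y" "Q (r *\<^sub>R x) (s *\<^sub>R y) = r * s * Q x y"
    for r s x y
    by (simp_all add: H_def Q_def diag_metric_def algebra_simps)
  have unique: "h = cross_curvature_diag a b c"
    if h: "is_cross_curvature (diag_metric a b c) h" for h
  proof -
    obtain e k where *: "bilinear h \<and> orthonormal_frame ?g e \<and>
        (\<forall>i j. i \<noteq> j \<longrightarrow> ricci ?g (e i) (e j) = 0) \<and>
        (\<forall>i j l. distinct [i, j, l] \<longrightarrow> k i = sectional ?g (e j) (e l)) \<and>
        (\<forall>i j. i \<noteq> j \<longrightarrow> h (e i) (e j) = 0) \<and>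
        (\<forall>i j l. distinct [i, j, l] \<longrightarrow> h (e i) (e i) = k j * k l)"
      using h unfolding is_cross_curvature_def by (elim conjE exE) (rule that, intro conjI)
    have bil: "bilinear h" and e: "orthonormal_frame ?g e"
      using * by simp_all
    have ric0: "ricci ?g (e i) (e j) = 0" and h0: "h (e i) (e j) = 0" if "i \<noteq> j" for i j
      using * that by simp_all
    have k: "k i = sectional ?g (e j) (e l)" and hk: "h (e i) (e i) = k j * k l"
      if "distinct [i, j, l]" for i j l
      using * that by (elim conjE, simp only:)+
    have ge: "?g (e i) (e j) = (if i = j then 1 else 0)" for i j
      using e by (simp add: orthonormal_frame_def)
    have Q0: "Q (p (e i)) (p (e j)) = 0" if "i \<noteq> j" for i j
      using ric0[OF that] ric[of "e i" "e j"] ge that by simp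
    have frame: "\<exists>r. r * r = 1 \<and> p (e i) = r *\<^sub>R cross3 (p (e j)) (p (e l)) \<and>
        p (e j) = r *\<^sub>R cross3 (p (e l)) (p (e i))" if "distinct [i, j, l]" for i j l
      using orthonormal_cross[of "p (e i)" "p (e j)" "p (e l)"] that by (auto simp: gp ge)
    have kQ: "k i = Q (p (e i)) (p (e i))" if ijl: "distinct [i, j, l]" for i j l
    proof -
      obtain r where "r * r = 1" "p (e i) = r *\<^sub>R cross3 (p (e j)) (p (e l))"
        using frame[OF ijl] by blast
      then show ?thesis
        using ijl by (simp add: k[OF ijl] sectional_def curv ge scale)
    qed
    have hH: "h (e i) (e j) = H (p (e i)) (p (e j))" for i j
    proof (cases "i = j")
      case True
      \<comment> \<open>The index \<open>i\<close> differs from \<open>1\<close> or from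
        \<open>2\<close>, so at least one of the two instances supplies a triple.\<close>
      obtain m l where ml: "distinct [i, m, l]"
        using third_index[of i 1] third_index[of i 2] by fastforce
      then have "k m = Q (p (e m)) (p (e m))" "k l = Q (p (e l)) (p (e l))"
        using kQ[of m l i] kQ[of l i m] by auto
      moreover obtain r where "r * r = 1" "p (e i) = r *\<^sub>R cross3 (p (e m)) (p (e l))"
        using frame[OF ml] by blast
      ultimately show ?thesis
        using ml by (simp add: hk[OF ml] scale binet Q0 flip: True)
    next
      case False
      obtain l where ijl: "distinct [i, j, l]"
        using third_index[OF False] by blast
      obtain r where r: "r * r = 1" "p (e i) = r *\<^sub>R cross3 (p (e j)) (p (e l))"
        "p (e j) = r *\<^sub>R cross3 (p (e l)) (p (e i))"
        using frame[OF ijl] by blast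
      \<comment> \<open>Both products in the Binet-Cauchy identity contain an off-diagonal value of
        \<open>Q\<close> on the frame, so both vanish by \<open>Q0\<close>.\<close>
      have "H (p (e i)) (p (e j)) =
          H (r *\<^sub>R cross3 (p (e j)) (p (e l))) (r *\<^sub>R cross3 (p (e l)) (p (e i)))"
        using r(2,3) by simp
      also have "\<dots> = 0"
        using ijl False by (simp only: scale binet) (simp add: Q0)
      finally show ?thesis
        using h0[OF False] by simp
    qed
    \<comment> \<open>Two bilinear forms that agree on the frame are equal once the frame spans.
      Subtracting the orthonormal expansion of \<open>v\<close> leaves a vector orthogonal to the
      whole frame, which must be \<open>0\<close>.\<close>
    have span: "v \<in> span (range e)" for v
    proof -
      define w where "w = v - (\<Sum>i\<in>UNIV. ?g v (e i) *\<^sub>R e i)"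
      have "?g w (e j) = 0" for j
      proof -
        have "?g w (e j) = ?g v (e j) - (\<Sum>i\<in>UNIV. ?g v (e i) * ?g (e i) (e j))"
          unfolding w_def sum_3 by (simp add: diag_metric_def algebra_simps)
        also have "\<dots> = 0"
          using exhaust_3[of j] by (auto simp: ge sum_3)
        finally show ?thesis .
      qed
      then have "p w = 0"
        using orthonormal_complement[of "p (e 1)" "p (e 2)" "p (e 3)" "p w"]
        by (simp add: gp ge)
      then have "w = 0"
        using pos by (simp add: p_def vec_eq_iff forall_3)
      then have "v = (\<Sum>i\<in>UNIV. ?g v (e i) *\<^sub>R e i)"
        by (simp add: w_def)
      also have "\<dots> \<in> span (range e)"
        by (intro span_sum span_scale span_base) auto
      finally show ?thesis .
    qed
    show ?thesis
    proof (intro ext)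
      fix u v
      show "h u v = cross_curvature_diag a b c u v"
        by (rule bilinear_eq[OF bil _ order_refl order_refl span span])
          (auto simp: cross_curvature_diag_def bilinear_diag_metric hH Hp)
    qed
  qed
  have "is_cross_curvature ?g (cross_curvature_diag a b c)"
  proof -
    \<comment> \<open>For existence the frame is the normalized \<open>f\<^sub>i\<close>, which
      \<open>p\<close> sends to the standard basis, where \<open>Q\<close> and \<open>H\<close> are
      diagonal.\<close>
    define e :: "3 \<Rightarrow> real^3" where
      "e i = (if i = 1 then axis 1 (1 / sqrt a) else if i = 2 then axis 2 (1 / sqrt b)
        else axis 3 (1 / sqrt c))" for i
    define k :: "3 \<Rightarrow> real" where
      "k i = (if i = 1 then k1 else if i = 2 then k2 else k3)" for i
    have pe: "p (e 1) = axis 1 1" "p (e 2) = axis 2 1" "p (e 3) = axis 3 1"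
      using pos by (simp_all add: p_def e_def axis_def vec_eq_iff forall_3)
    have QH: "Q (axis i 1) (axis j 1) = (if i = j then k i else 0)"
       "H (axis i 1) (axis j 1) = (if i \<noteq> j then 0 else if i = 1 then k2 * k3 else
          if i = 2 then k1 * k3 else k1 * k2)" for i j
      using exhaust_3[of i] exhaust_3[of j]
      by (auto simp: Q_def H_def k_def) (auto simp: axis_def)
    have ge: "?g (e i) (e j) = (if i = j then 1 else 0)" for i j
      using exhaust_3[of i] exhaust_3[of j]
      by (auto simp flip: gp simp: pe inner_axis_axis)
    have "sectional ?g (e j) (e l) = k i" if "distinct [i, j, l]" for i j l
      using that exhaust_3[of i] exhaust_3[of j] exhaust_3[of l]
      by (auto simp: sectional_def ge curv pe cross_basis)
         (auto simp: QH Q_def diag_metric_def k_def axis_def)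
    moreover have "ricci ?g (e i) (e j) = 0" if "i \<noteq> j" for i j
      using that exhaust_3[of i] exhaust_3[of j] by (auto simp: ric ge pe QH)
    moreover have "cross_curvature_diag a b c (e i) (e j) = 0" if "i \<noteq> j" for i j
      using that exhaust_3[of i] exhaust_3[of j] by (auto simp flip: Hp simp: pe QH)
    moreover have "cross_curvature_diag a b c (e i) (e i) = k j * k l"
      if "distinct [i, j, l]" for i j l
      using that exhaust_3[of i] exhaust_3[of j] exhaust_3[of l]
      by (auto simp flip: Hp simp: pe QH k_def)
    ultimately show ?thesis
      unfolding is_cross_curvature_def orthonormal_frame_def
      using ge by (intro conjI exI[of _ e] exI[of _ k])
        (auto simp: cross_curvature_diag_def bilinear_diag_metric)
  qed
  then show ?thesis
    using unique by blast
qed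

end

section \<open>Reduction to ordinary differential equations\<close>

text \<open>In each product of two curvatures the signs in \<open>sec1\<close>, \<open>sec2\<close>,
  \<open>sec3\<close> cancel, so the right-hand sides are 2AYZ/(ABC)^2, 2BZX/(ABC)^2 and
  2CXY/(ABC)^2. Positivity is included to encode that the tensor is a metric.\<close>

definition xcf_ode :: "(real \<Rightarrow> real) \<Rightarrow> (real \<Rightarrow> real) \<Rightarrow> (real \<Rightarrow> real) \<Rightarrow> real \<Rightarrow> bool" where
  "xcf_ode A B C t \<longleftrightarrow> A t > 0 \<and> B t > 0 \<and> C t > 0 \<and>
     (A has_real_derivative 2 * (A t * (sec2 (A t) (B t) (C t) * sec3 (A t) (B t) (C t))))
       (at t within {0..}) \<and>
     (B has_real_derivative 2 * (B t * (sec1 (A t) (B t) (C t) * sec3 (A t) (B t) (C t))))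
       (at t within {0..}) \<and>
     (C has_real_derivative 2 * (C t * (sec1 (A t) (B t) (C t) * sec2 (A t) (B t) (C t))))
       (at t within {0..})"

text \<open>The cross curvature of a diagonal metric is unique and again diagonal, so the tensor
  equation amounts to its three diagonal entries.\<close>

lemma pxcf_solution_diag_iff:
  "pxcf_solution S (\<lambda>t. diag_metric (A t) (B t) (C t)) \<longleftrightarrow>
     S > 0 \<and> (\<forall>t\<ge>0. ereal t < S \<longrightarrow> xcf_ode A B C t)"
proof -
  have "riemannian_metric (diag_metric (A t) (B t) (C t)) \<and>
      (\<exists>h. is_cross_curvature (diag_metric (A t) (B t) (C t)) h \<and>
        (\<forall>u v. ((\<lambda>s. diag_metric (A s) (B s) (C s) u v) has_real_derivative 2 * h u v)
          (at t within {0..}))) \<longleftrightarrow> xcf_ode A B C t" for t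
  proof (cases "A t > 0 \<and> B t > 0 \<and> C t > 0")
    case False
    then show ?thesis
      by (auto simp: riemannian_diag_metric_iff xcf_ode_def)
  next
    case True
    have "(\<forall>u v. ((\<lambda>s. diag_metric (A s) (B s) (C s) u v) has_real_derivative
        2 * cross_curvature_diag (A t) (B t) (C t) u v) (at t within {0..})) \<longleftrightarrow> xcf_ode A B C t"
      (is "?L \<longleftrightarrow> _")
    proof
      assume ?L
      then have "((\<lambda>s. diag_metric (A s) (B s) (C s) (axis i 1) (axis i 1)) has_real_derivative
        2 * cross_curvature_diag (A t) (B t) (C t) (axis i 1) (axis i 1)) (at t within {0..})"
        for i by blast
      from this[of 1] this[of 2] this[of 3] show "xcf_ode A B C t"
        using True by (simp add: xcf_ode_def cross_curvature_diag_def)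
    next
      assume "xcf_ode A B C t"
      then have d: "(A has_real_derivative 2 * (A t * (sec2 (A t) (B t) (C t) * sec3 (A t) (B t) (C t))))
          (at t within {0..})"
        "(B has_real_derivative 2 * (B t * (sec1 (A t) (B t) (C t) * sec3 (A t) (B t) (C t))))
          (at t within {0..})"
        "(C has_real_derivative 2 * (C t * (sec1 (A t) (B t) (C t) * sec2 (A t) (B t) (C t))))
          (at t within {0..})"
        by (auto simp: xcf_ode_def)
      show ?L
        unfolding cross_curvature_diag_def diag_metric_def
        by (auto intro!: derivative_eq_intros d simp: algebra_simps)
    qed
    then show ?thesis
      using True by (simp add: riemannian_diag_metric_iff is_cross_curvature_diag_iff)
  qed
  then show ?thesis
    by (simp add: pxcf_solution_def)
qed

section \<open>Conserved quantities and the sign of A - B\<close>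

lemma constant_if_derivative_zero:
  fixes f :: "real \<Rightarrow> real"
  assumes "\<And>t. \<lbrakk>0 \<le> t; ereal t < S\<rbrakk> \<Longrightarrow> (f has_real_derivative 0) (at t within {0..})"
    and "0 \<le> t" "ereal t < S"
  shows "f t = f 0"
proof -
  have "(f has_real_derivative 0) (at s within {0..t})" if "s \<in> {0..t}" for s
  proof (rule DERIV_subset[OF assms(1)])
    show "ereal s < S"
      using that assms(3) by (metis atLeastAtMost_iff ereal_less_eq(3) order.strict_trans1)
  qed (use that in auto)
  then obtain c where "\<And>s. s \<in> {0..t} \<Longrightarrow> f s = c"
    using has_field_derivative_zero_constant[of "{0..t}" f] by auto
  with assms(2) show ?thesis
    by simp
qed

text \<open>The first relation makes AB(A + B)^2 stationary; the other two do the same for C^2(A -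
  B)^4/(AB) by trading \<open>sec3\<close> for \<open>sec1\<close> and \<open>sec2\<close>.\<close>

lemma sec_relations:
  "sec2 a b c * (3 * a + b) + sec1 a b c * (a + 3 * b) = 0"
  "sec3 a b c * (3 * a + b) = - (sec1 a b c * (a - b))"
  "sec3 a b c * (a + 3 * b) = sec2 a b c * (a - b)"
  by (simp_all add: sec1_def sec2_def sec3_def divide_inverse algebra_simps power2_eq_square)

context
  fixes A B C :: "real \<Rightarrow> real" and S :: ereal
  assumes ode: "\<And>t. \<lbrakk>0 \<le> t; ereal t < S\<rbrakk> \<Longrightarrow> xcf_ode A B C t"
begin

text \<open>Since A'/A = 2 \<open>k2\<close> \<open>k3\<close> and B'/B = 2 \<open>k1\<close>
  \<open>k3\<close>, the factor \<open>k3\<close> comes out of the derivative, and what remains is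
  the vanishing combination in \<open>sec_relations\<close>.\<close>

lemma conserved_fourth_power:
  assumes "0 \<le> t" "ereal t < S"
  shows "A t * B t * (A t + B t)\<^sup>2 = A 0 * B 0 * (A 0 + B 0)\<^sup>2"
proof (rule constant_if_derivative_zero[OF _ assms])
  fix t :: real assume t: "0 \<le> t" "ereal t < S"
  define a b c k1 k2 k3 where "a = A t" and "b = B t" and "c = C t"
    and "k1 = sec1 a b c" and "k2 = sec2 a b c" and "k3 = sec3 a b c"
  note defs = a_def b_def c_def k1_def k2_def k3_def
  have d: "(A has_real_derivative 2 * (a * (k2 * k3))) (at t within {0..})"
    "(B has_real_derivative 2 * (b * (k1 * k3))) (at t within {0..})"
    using ode[OF t] by (auto simp: xcf_ode_def defs)
  have 1: "k2 * (3 * a + b) + k1 * (a + 3 * b) = 0"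
    unfolding k1_def k2_def by (rule sec_relations)
  have "((\<lambda>t. A t * B t * (A t + B t)\<^sup>2) has_real_derivative
      2 * a * b * (a + b) * k3 * (k2 * (3 * a + b) + k1 * (a + 3 * b))) (at t within {0..})"
    by (rule derivative_eq_intros d refl)+ (simp add: algebra_simps power2_eq_square flip: a_def b_def)
  then show "((\<lambda>t. A t * B t * (A t + B t)\<^sup>2) has_real_derivative 0) (at t within {0..})"
    by (simp add: 1)
qed

text \<open>This quantity vanishes exactly where A = B, so it shows both that equality persists and
  that strict inequality does; it also determines C from A and B. After common factors are removed,
  \<open>sec_relations\<close> turns each remaining term into a multiple of
  \<open>k1 * k2 * (a - b)\<close>, and the multiples add up to zero.\<close>

lemma conserved_ratio:
  assumes "0 \<le> t" "ereal t < S"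
  shows "(C t)\<^sup>2 * (A t - B t)^4 / (A t * B t) = (C 0)\<^sup>2 * (A 0 - B 0)^4 / (A 0 * B 0)"
proof (rule constant_if_derivative_zero[OF _ assms])
  fix t :: real assume t: "0 \<le> t" "ereal t < S"
  define a b c k1 k2 k3 where "a = A t" and "b = B t" and "c = C t"
    and "k1 = sec1 a b c" and "k2 = sec2 a b c" and "k3 = sec3 a b c"
  note defs = a_def b_def c_def k1_def k2_def k3_def
  have d: "(A has_real_derivative 2 * (a * (k2 * k3))) (at t within {0..})"
    "(B has_real_derivative 2 * (b * (k1 * k3))) (at t within {0..})"
    "(C has_real_derivative 2 * (c * (k1 * k2))) (at t within {0..})"
    and pos: "a > 0" "b > 0" "c > 0"
    using ode[OF t] by (auto simp: xcf_ode_def defs)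
  have "2 * k1 * k2 * (a - b) + 4 * (a * (k2 * k3) - b * (k1 * k3)) - (a - b) * (k1 + k2) * k3
      = 2 * k1 * k2 * (a - b) + k2 * (k3 * (3 * a + b)) - k1 * (k3 * (a + 3 * b))"
    by (simp add: algebra_simps)
  also have "k3 * (3 * a + b) = - (k1 * (a - b))"
    unfolding k1_def k3_def by (rule sec_relations)
  also have "k3 * (a + 3 * b) = k2 * (a - b)"
    unfolding k2_def k3_def by (rule sec_relations)
  also have "2 * k1 * k2 * (a - b) + k2 * - (k1 * (a - b)) - k1 * (k2 * (a - b)) = 0"
    by (simp add: algebra_simps)
  finally have 1: "2 * k1 * k2 * (a - b) + 4 * (a * (k2 * k3) - b * (k1 * k3))
      - (a - b) * (k1 + k2) * k3 = 0" .
  have "((\<lambda>t. (C t)\<^sup>2 * (A t - B t)^4 / (A t * B t)) has_real_derivative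
      2 * c\<^sup>2 * (a - b)^3 / (a * b) * (2 * k1 * k2 * (a - b) +
      4 * (a * (k2 * k3) - b * (k1 * k3)) - (a - b) * (k1 + k2) * k3)) (at t within {0..})"
    using pos
    by (auto intro!: derivative_eq_intros d simp flip: a_def b_def c_def)
      (simp add: field_simps power2_eq_square power3_eq_cube power4_eq_xxxx)
  then show "((\<lambda>t. (C t)\<^sup>2 * (A t - B t)^4 / (A t * B t)) has_real_derivative 0)
      (at t within {0..})"
    by (simp only: 1 mult_zero_right)
qed

lemma ode_constant_if_eq:
  assumes "A 0 = B 0" and t: "0 \<le> t" "ereal t < S"
  shows "A t = A 0" "B t = A 0" "C t = C 0"
proof -
  have pos: "A s > 0" "B s > 0" "C s > 0" if "0 \<le> s" "ereal s < S" for s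
    using ode[OF that] by (auto simp: xcf_ode_def)
  have eq: "A s = B s" if "0 \<le> s" "ereal s < S" for s
    using conserved_ratio[OF that] pos[OF that] assms(1) by simp
  have 0: "sec1 a a c = 0" "sec2 a a c = 0" "sec3 a a c = 0" for a c
    by (simp_all add: sec1_def sec2_def sec3_def)
  have "(A has_real_derivative 0) (at s within {0..}) \<and>
      (C has_real_derivative 0) (at s within {0..})" if "0 \<le> s" "ereal s < S" for s
    using ode[OF that] eq[OF that] by (simp add: xcf_ode_def 0)
  then show "A t = A 0" "C t = C 0"
    using constant_if_derivative_zero[of S A] constant_if_derivative_zero[of S C] t by blast+
  then show "B t = A 0"
    using eq[OF t] by simp
qed

text \<open>Otherwise A - B has a zero by the intermediate value theorem, and there the second
  conserved quantity would be 0, although it is positive at time 0.\<close>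

lemma ode_less:
  assumes "B 0 < A 0" and t: "0 \<le> t" "ereal t < S"
  shows "B t < A t"
proof (rule ccontr)
  assume neg: "\<not> B t < A t"
  have S: "ereal s < S" if "s \<in> {0..t}" for s
    using that t(2) by (metis atLeastAtMost_iff ereal_less_eq(3) order.strict_trans1)
  have "continuous_on {0..t} (\<lambda>s. A s - B s)"
  proof (intro continuous_on_diff)
    have "continuous (at s within {0..t}) A \<and> continuous (at s within {0..t}) B"
      if "s \<in> {0..t}" for s
    proof -
      have "continuous (at s within {0..}) A" "continuous (at s within {0..}) B"
        using ode[OF _ S[OF that]] that by (auto simp: xcf_ode_def intro: DERIV_continuous)
      then show ?thesis
        by (auto intro: continuous_within_subset)
    qed
    then show "continuous_on {0..t} A" "continuous_on {0..t} B"
      by (simp_all add: continuous_on_eq_continuous_within)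
  qed
  then obtain s where s: "0 \<le> s" "s \<le> t" "A s - B s = 0"
    using IVT2'[of "\<lambda>s. A s - B s" t 0 0] neg assms(1) t(1) by auto
  have "A 0 > 0" "B 0 > 0" "C 0 > 0"
    using ode[of 0] S[of 0] t(1) by (auto simp: xcf_ode_def zero_ereal_def)
  then show False
    using conserved_ratio[of s] S[of s] s assms(1) by simp
qed

end

section \<open>The solution parametrized by the metric ratio\<close>

text \<open>
  Up to the factor \<open>K/(8n)\<close> this is the remaining lifetime of the solution whose ratio
  \<open>sqrt (B/A)\<close> is currently \<open>u\<close>.
\<close>

definition lifetime :: "real \<Rightarrow> real" where
  "lifetime u = integral {0..u} (\<lambda>v. 2 * v^6 / (1 - v\<^sup>2)^7)"

lemma one_minus_square_pos: "\<lbrakk>0 \<le> u; u < 1\<rbrakk> \<Longrightarrow> 1 - u\<^sup>2 > 0" for u :: real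
  by (simp add: abs_square_less_1)

lemma one_plus_square_neq_0: "1 + u\<^sup>2 \<noteq> 0" for u :: real
  by (smt (verit) zero_le_power2)

lemma lifetime_integrand_continuous:
  assumes "b < 1"
  shows "continuous_on {0..b} (\<lambda>v :: real. 2 * v^6 / (1 - v\<^sup>2)^7)"
proof -
  have "(1 - v\<^sup>2)^7 \<noteq> 0" if "v \<in> {0..b}" for v
    using one_minus_square_pos[of v] that assms by auto
  then show ?thesis
    by (intro continuous_intros) auto
qed

lemma lifetime_0 [simp]: "lifetime 0 = 0"
  by (simp add: lifetime_def)

lemma lifetime_continuous:
  assumes "b < 1"
  shows "continuous_on {0..b} lifetime"
  unfolding lifetime_def
  by (intro indefinite_integral_continuous_1 integrable_continuous_interval
      lifetime_integrand_continuous assms)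

lemma lifetime_derivative:
  assumes "0 < u" "u < 1"
  shows "(lifetime has_real_derivative 2 * u^6 / (1 - u\<^sup>2)^7) (at u)"
proof -
  \<comment> \<open>The fundamental theorem gives a derivative within \<open>{0..b}\<close>;
    choosing \<open>b\<close> beyond \<open>u\<close> makes \<open>u\<close> an interior
    point.\<close>
  obtain b where b: "u < b" "b < 1"
    using dense[OF assms(2)] by blast
  have "(lifetime has_real_derivative 2 * u^6 / (1 - u\<^sup>2)^7) (at u within {0..b})"
    using integral_has_real_derivative[OF lifetime_integrand_continuous[OF b(2)], of u] b assms
    by (simp add: lifetime_def[abs_def])
  then show ?thesis
    using assms b by (simp add: at_within_Icc_at)
qed

lemma lifetime_strict_mono:
  assumes "0 \<le> u" "u < v" "v < 1"
  shows "lifetime u < lifetime v"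
proof (rule DERIV_pos_imp_increasing_open[OF assms(2)])
  show "\<exists>y. (lifetime has_real_derivative y) (at x) \<and> y > 0" if "u < x" "x < v" for x
    using lifetime_derivative[of x] one_minus_square_pos[of x] that assms
    by (intro exI conjI) auto
  show "continuous_on {u..v} lifetime"
    using lifetime_continuous[OF assms(3)] by (rule continuous_on_subset) (use assms in auto)
qed

lemma lifetime_inj: "inj_on lifetime {0<..<1}"
proof (rule inj_onI)
  fix x y assume "x \<in> {0<..<1}" "y \<in> {0<..<1}" "lifetime x = lifetime y"
  then show "x = y"
    using lifetime_strict_mono[of x y] lifetime_strict_mono[of y x] by force
qed

lemma lifetime_pos: "\<lbrakk>0 < u; u < 1\<rbrakk> \<Longrightarrow> lifetime u > 0"
  using lifetime_strict_mono[of 0 u] by simp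

text \<open>On \<open>{0..u}\<close> the factor (1 - v^2)^7 lies between (1 - u^2)^7 and 1, so the
  integrand lies between two constant multiples of v^6. The bounds have ratio tending to 1 as u
  tends to 0, which later gives the sharp rate for u.\<close>

lemma lifetime_bounds:
  assumes "0 < u" "u < 1"
  shows "2 / 7 * u^7 \<le> lifetime u" "lifetime u \<le> 2 / 7 * u^7 / (1 - u\<^sup>2)^7"
proof -
  have int: "((\<lambda>v. 2 * v^6 * c) has_integral 2 / 7 * u^7 * c) {0..u}" for c
  proof -
    have "((\<lambda>v. 2 * v^6 * c) has_integral (2 / 7 * u^7 * c - 2 / 7 * 0^7 * c)) {0..u}"
      by (rule fundamental_theorem_of_calculus)
        (use assms in \<open>auto intro!: derivative_eq_intros
          simp flip: has_real_derivative_iff_has_vector_derivative\<close>)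
    then show ?thesis
      by simp
  qed
  have E: "((\<lambda>v. 2 * v^6 / (1 - v\<^sup>2)^7) has_integral lifetime u) {0..u}"
    unfolding lifetime_def
    by (intro integrable_integral integrable_continuous_interval lifetime_integrand_continuous assms)
  have sq: "0 < (1 - u\<^sup>2)^7" "(1 - u\<^sup>2)^7 \<le> (1 - v\<^sup>2)^7" "(1 - v\<^sup>2)^7 \<le> 1"
    if "v \<in> {0..u}" for v
  proof -
    have "0 < 1 - u\<^sup>2" "1 - u\<^sup>2 \<le> 1 - v\<^sup>2"
      using one_minus_square_pos[of u] assms that by (auto intro: power_mono)
    then show "0 < (1 - u\<^sup>2)^7" "(1 - u\<^sup>2)^7 \<le> (1 - v\<^sup>2)^7" "(1 - v\<^sup>2)^7 \<le> 1"
      by (auto intro!: power_mono power_le_one)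
  qed
  have "2 * v^6 * 1 \<le> 2 * v^6 / (1 - v\<^sup>2)^7" if "v \<in> {0..u}" for v
    by (subst pos_le_divide_eq[OF order.strict_trans2[OF sq(1)[OF that] sq(2)[OF that]]])
      (use sq(3)[OF that] in \<open>simp add: mult_left_le\<close>)
  from has_integral_le[OF int[of 1] E this] show "2 / 7 * u^7 \<le> lifetime u"
    by simp
  have "2 * v^6 / (1 - v\<^sup>2)^7 \<le> 2 * v^6 * (1 / (1 - u\<^sup>2)^7)" if "v \<in> {0..u}" for v
    using sq[OF that] by (simp add: frac_le)
  from has_integral_le[OF E int this] show "lifetime u \<le> 2 / 7 * u^7 / (1 - u\<^sup>2)^7"
    by simp
qed

section \<open>Closed formulas for the metric in terms of the ratio\<close>

text \<open>Substituting B = u^2 A into AB(A + B)^2 = n^2 and taking the positive root gives n = u(1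
  + u^2)A^2.\<close>

definition sol_A :: "real \<Rightarrow> real \<Rightarrow> real" where
  "sol_A n u = sqrt (n / (u * (1 + u\<^sup>2)))"

definition sol_B :: "real \<Rightarrow> real \<Rightarrow> real" where
  "sol_B n u = u\<^sup>2 * sol_A n u"

text \<open>With B = u^2 A the second constant is K = C^2 A^2 (1 - u^2)^4 / u^2, solved here for
  C.\<close>

definition sol_C :: "real \<Rightarrow> real \<Rightarrow> real \<Rightarrow> real" where
  "sol_C n K u = sqrt K * u / (sol_A n u * (1 - u\<^sup>2)\<^sup>2)"

lemma sol_unique:
  fixes a b c :: real
  assumes "0 < b" "b < a" "0 < c"
  defines "u \<equiv> sqrt (b / a)"
  assumes n: "a * b * (a + b)\<^sup>2 = n\<^sup>2" "n > 0" and K: "c\<^sup>2 * (a - b)^4 / (a * b) = K"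
  shows "0 < u" "u < 1" "a = sol_A n u" "b = sol_B n u" "c = sol_C n K u"
proof -
  show u: "0 < u" "u < 1"
    using assms by (simp_all add: u_def)
  have b: "b = u\<^sup>2 * a"
    using assms by (simp add: u_def)
  have "(u * a * (a + b))\<^sup>2 = n\<^sup>2"
    unfolding n(1)[symmetric] by (simp add: b power2_eq_square)
  then have n': "n = u * a * (a + b)"
    using assms(1-3) u n(2) by (simp add: power2_eq_iff_nonneg)
  have "n / (u * (1 + u\<^sup>2)) = a\<^sup>2"
    unfolding n' using u one_plus_square_neq_0[of u]
    by (simp add: b divide_simps) (simp add: algebra_simps power2_eq_square)
  then show a: "a = sol_A n u"
    using assms by (simp add: sol_A_def)
  show "b = sol_B n u"
    unfolding sol_B_def a[symmetric] by (rule b)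
  have "(c * (a - b)\<^sup>2 / (u * a))\<^sup>2 = K"
    unfolding K[symmetric] using assms(1-3) u
    by (simp add: b power_divide power_mult_distrib power2_eq_square power4_eq_xxxx mult_ac)
  then have "sqrt K = c * (a - b)\<^sup>2 / (u * a)"
    using assms(1-3) u by (simp add: real_sqrt_unique)
  moreover define r where "r = 1 - u\<^sup>2"
  moreover have "r > 0"
    using one_minus_square_pos[of u] u by (simp add: r_def)
  moreover have "a - b = a * r"
    by (simp add: b r_def algebra_simps)
  ultimately show "c = sol_C n K u"
    unfolding sol_C_def a[symmetric] r_def[symmetric] using assms(1-3) u
    by (simp add: field_simps power2_eq_square)
qed

context
  fixes n K :: real
  assumes nK: "n > 0" "K > 0"
begin

lemma sol_pos:
  assumes "0 < u" "u < 1"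
  shows "sol_A n u > 0" "sol_B n u > 0" "sol_C n K u > 0"
  using assms nK one_minus_square_pos[of u]
  by (simp_all add: sol_A_def sol_B_def sol_C_def add_pos_pos)

lemma sol_A_square: "0 < u \<Longrightarrow> (sol_A n u)\<^sup>2 * (u * (1 + u\<^sup>2)) = n"
  using nK one_plus_square_neq_0[of u] by (simp add: sol_A_def add_pos_pos)

text \<open>The factor is q'/(2q) for q = u(1 + u^2), because \<open>sol_A n u\<close> is sqrt
  (n/q).\<close>

lemma sol_A_derivative:
  assumes "0 < u"
  shows "(sol_A n has_real_derivative - sol_A n u * ((1 + 3 * u\<^sup>2) / (2 * (u * (1 + u\<^sup>2))))) (at u)"
proof -
  let ?q = "u * (1 + u\<^sup>2)"
  have q: "?q > 0" "n / ?q > 0"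
    using assms nK by (simp_all add: add_pos_pos)
  have "((\<lambda>u. n / (u * (1 + u\<^sup>2))) has_real_derivative - (n / ?q) * ((1 + 3 * u\<^sup>2) / ?q)) (at u)"
    using q assms by (auto intro!: derivative_eq_intros simp: divide_simps power2_eq_square
      algebra_simps)
  from DERIV_chain'[OF this DERIV_real_sqrt[OF q(2)]]
  have *: "(sol_A n has_real_derivative - (n / ?q) * ((1 + 3 * u\<^sup>2) / ?q) *
      (inverse (sqrt (n / ?q)) / 2)) (at u)"
    by (simp add: sol_A_def[abs_def] mult.commute)
  define x where "x = sqrt (n / ?q)"
  have x: "x > 0" "n / ?q = x * x"
    using q(2) by (simp_all only: x_def real_sqrt_gt_zero real_sqrt_mult_self abs_of_pos)
  have "- (n / ?q) * ((1 + 3 * u\<^sup>2) / ?q) * (inverse (sqrt (n / ?q)) / 2) =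
      - (x * x) * ((1 + 3 * u\<^sup>2) / ?q) * (inverse x / 2)"
    unfolding x_def[symmetric] unfolding x(2) ..
  also have "\<dots> = - x * ((1 + 3 * u\<^sup>2) / (2 * ?q))"
  proof -
    have "- (x * x) * (p / r) * (inverse x / 2) = - x * (p / (2 * r))" if "r > 0" for p r
      using x(1) that by (simp add: field_simps)
    then show ?thesis
      using q(1) by blast
  qed
  also have "x = sol_A n u"
    by (simp add: x_def sol_A_def)
  finally show ?thesis
    using * by simp
qed

lemma sol_B_derivative:
  assumes "0 < u"
  shows "(sol_B n has_real_derivative sol_B n u * ((3 + u\<^sup>2) / (2 * (u * (1 + u\<^sup>2))))) (at u)"
proof -
  define a q where "a = sol_A n u" and "q = 1 + u\<^sup>2"
  have q: "q > 0"
    by (simp add: q_def add_pos_nonneg)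
  have dA: "(sol_A n has_real_derivative - a * ((1 + 3 * u\<^sup>2) / (2 * (u * q)))) (at u)"
    using sol_A_derivative[OF assms(1)] by (simp add: a_def q_def)
  have "((\<lambda>u. u\<^sup>2 * sol_A n u) has_real_derivative
      u\<^sup>2 * a * (2 / u - (1 + 3 * u\<^sup>2) / (2 * (u * q)))) (at u)"
    using assms q
    by (auto intro!: derivative_eq_intros dA simp flip: a_def)
      (simp add: field_simps power2_eq_square)
  also have "2 / u - (1 + 3 * u\<^sup>2) / (2 * (u * q)) = (4 * q - (1 + 3 * u\<^sup>2)) / (2 * (u * q))"
    using assms q by (simp add: field_simps)
  also have "4 * q - (1 + 3 * u\<^sup>2) = 3 + u\<^sup>2"
    by (simp add: q_def)
  finally show ?thesis
    by (simp add: sol_B_def[abs_def] a_def q_def)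
qed

lemma sol_C_derivative:
  assumes "0 < u" "u < 1"
  shows "(sol_C n K has_real_derivative
    sol_C n K u * ((3 + u\<^sup>2) * (1 + 3 * u\<^sup>2) / (2 * (u * (1 + u\<^sup>2)) * (1 - u\<^sup>2)))) (at u)"
proof -
  define a q r where "a = sol_A n u" and "q = 1 + u\<^sup>2" and "r = 1 - u\<^sup>2"
  have pos: "a > 0" "q > 0" "r > 0"
    using sol_pos[OF assms] one_minus_square_pos[of u] assms
    by (simp_all add: a_def q_def r_def add_pos_nonneg)
  have dA: "(sol_A n has_real_derivative - a * ((1 + 3 * u\<^sup>2) / (2 * (u * q)))) (at u)"
    using sol_A_derivative[OF assms(1)] by (simp add: a_def q_def)
  have "((\<lambda>u. sqrt K * u / (sol_A n u * (1 - u\<^sup>2)\<^sup>2)) has_real_derivative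
      sqrt K * u / (a * r\<^sup>2) * (1 / u + (1 + 3 * u\<^sup>2) / (2 * (u * q)) + 4 * u / r)) (at u)"
    using assms pos
    by (auto intro!: derivative_eq_intros dA simp flip: a_def r_def)
      (simp add: field_simps power2_eq_square)
  also have "1 / u + (1 + 3 * u\<^sup>2) / (2 * (u * q)) + 4 * u / r =
      (2 * q * r + (1 + 3 * u\<^sup>2) * r + 8 * u\<^sup>2 * q) / (2 * (u * q) * r)"
    using assms pos by (simp add: field_simps power2_eq_square)
  \<comment> \<open>The numerator factors into exactly the two polynomials that occur in
    \<open>k1 * k2\<close> in \<open>sol_sec\<close>, which is what the equation for C
    requires.\<close>
  also have "2 * q * r + (1 + 3 * u\<^sup>2) * r + 8 * u\<^sup>2 * q = (3 + u\<^sup>2) * (1 + 3 * u\<^sup>2)"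
    by (simp add: q_def r_def algebra_simps)
  finally show ?thesis
    by (simp add: sol_C_def[abs_def] a_def q_def r_def)
qed

text \<open>Each curvature is a polynomial in u times \<open>D\<close> = 1/(u^2 c). Products of two
  curvatures contain only \<open>D * D\<close>, from which the square roots in \<open>sol_A\<close>
  and \<open>sol_C\<close> disappear.\<close>

lemma sol_sec:
  assumes "0 < u" "u < 1"
  defines "k1 \<equiv> sec1 (sol_A n u) (sol_B n u) (sol_C n K u)"
    and "k2 \<equiv> sec2 (sol_A n u) (sol_B n u) (sol_C n K u)"
    and "k3 \<equiv> sec3 (sol_A n u) (sol_B n u) (sol_C n K u)"
  shows "k2 * k3 = (1 - u\<^sup>2)^7 * (1 + 3 * u\<^sup>2) * (n / (K * u^7 * (1 + u\<^sup>2)))"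
    and "k1 * k3 = - ((1 - u\<^sup>2)^7 * (3 + u\<^sup>2) * (n / (K * u^7 * (1 + u\<^sup>2))))"
    and "k1 * k2 = - ((1 - u\<^sup>2)^6 * (3 + u\<^sup>2) * (1 + 3 * u\<^sup>2) * (n / (K * u^7 * (1 + u\<^sup>2))))"
proof -
  define a c r D where "a = sol_A n u" and "c = sol_C n K u" and "r = 1 - u\<^sup>2"
    and "D = 1 / (u\<^sup>2 * c)"
  have b: "sol_B n u = u\<^sup>2 * a"
    by (simp add: sol_B_def a_def)
  have pos: "a > 0" "c > 0" "r > 0"
    using sol_pos[OF assms(1,2)] one_minus_square_pos[of u] assms(1,2)
    by (simp_all add: a_def c_def r_def)
  have k: "k1 = - (r * (3 + u\<^sup>2) * D)" "k2 = r * (1 + 3 * u\<^sup>2) * D" "k3 = r\<^sup>2 * D"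
    unfolding k1_def k2_def k3_def b a_def[symmetric] c_def[symmetric] sec1_def sec2_def sec3_def
      D_def r_def
    using assms(1,2) pos by (simp_all add: field_simps power2_eq_square)
  have C: "c = sqrt K * u / (a * r\<^sup>2)"
    by (simp add: c_def sol_C_def a_def r_def)
  have "D = a * r\<^sup>2 / (sqrt K * u^3)"
    using assms(1,2) pos nK unfolding D_def C
    by (simp add: field_simps power2_eq_square power3_eq_cube)
  then have "D\<^sup>2 = a\<^sup>2 * (r\<^sup>2)\<^sup>2 / (K * (u^3)\<^sup>2)"
    using nK by (simp add: power_mult_distrib power_divide)
  also have "a\<^sup>2 = n / (u * (1 + u\<^sup>2))"
    using sol_A_square[OF assms(1)] assms(1) one_plus_square_neq_0[of u]
    by (simp add: a_def eq_divide_eq)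
  finally have D2: "D * D = r^4 * (n / (K * u^7 * (1 + u\<^sup>2)))"
    using assms(1) nK by (simp add: field_simps eval_nat_numeral)
  have r: "r^7 = r * r\<^sup>2 * r^4" "r^6 = r * r * r^4"
    by (simp_all add: eval_nat_numeral)
  have "k2 * k3 = r * r\<^sup>2 * (1 + 3 * u\<^sup>2) * (D * D)" "k1 * k3 = - (r * r\<^sup>2 * (3 + u\<^sup>2) * (D * D))"
    "k1 * k2 = - (r * r * (3 + u\<^sup>2) * (1 + 3 * u\<^sup>2) * (D * D))"
    by (simp_all add: k)
  then show "k2 * k3 = (1 - u\<^sup>2)^7 * (1 + 3 * u\<^sup>2) * (n / (K * u^7 * (1 + u\<^sup>2)))"
    and "k1 * k3 = - ((1 - u\<^sup>2)^7 * (3 + u\<^sup>2) * (n / (K * u^7 * (1 + u\<^sup>2))))"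
    and "k1 * k2 = - ((1 - u\<^sup>2)^6 * (3 + u\<^sup>2) * (1 + 3 * u\<^sup>2) * (n / (K * u^7 * (1 + u\<^sup>2))))"
    unfolding D2 r_def[symmetric] r by (simp_all only: mult.assoc mult.left_commute mult.commute)
qed

text \<open>By the chain rule each coefficient changes by its logarithmic derivative in u times u'.
  The numerators 1 + 3u^2, 3 + u^2 and their product already match \<open>sol_sec\<close>, so only
  powers of u and 1 - u^2 and the constants have to be compared.\<close>

lemma sol_ode:
  assumes u: "0 < u t" "u t < 1"
    and du: "(u has_real_derivative - (8 * n / K) * ((1 - (u t)\<^sup>2)^7 / (2 * (u t)^6)))
      (at t within {0..})"
  shows "xcf_ode (\<lambda>t. sol_A n (u t)) (\<lambda>t. sol_B n (u t)) (\<lambda>t. sol_C n K (u t)) t"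
proof -
  define v r q M where "v = u t" and "r = 1 - v\<^sup>2" and "q = 1 + v\<^sup>2" and "M = n / K"
  have pos: "v > 0" "r > 0" "q > 0" "M > 0"
    using u one_minus_square_pos[of v] nK by (simp_all add: v_def r_def q_def M_def add_pos_nonneg)
  have M: "n / (K * v^7 * q) = M / (v^7 * q)"
    using nK by (simp add: M_def)
  have du': "(u has_real_derivative - (8 * M) * (r^7 / (2 * v^6))) (at t within {0..})"
    using du by (simp add: M_def r_def v_def)
  note d = DERIV_chain2[OF sol_A_derivative[OF u(1)] du', folded v_def, folded q_def]
    DERIV_chain2[OF sol_B_derivative[OF u(1)] du', folded v_def, folded q_def]
    DERIV_chain2[OF sol_C_derivative[OF u] du', folded v_def, folded q_def r_def]
  note sec = sol_sec[OF u, folded v_def, folded r_def q_def, unfolded M]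
  have v7: "v^7 = v * v^6" and r7: "r^7 = r * r^6"
    by (simp_all add: eval_nat_numeral)
  have A: "- x * (N / (2 * (v * q))) * (- (8 * M) * (r^7 / (2 * v^6))) =
      2 * (x * (r^7 * N * (M / (v^7 * q))))" for x N
    using pos unfolding v7 by (simp add: field_simps)
  have B: "x * (N / (2 * (v * q))) * (- (8 * M) * (r^7 / (2 * v^6))) =
      2 * (x * - (r^7 * N * (M / (v^7 * q))))" for x N
    using pos unfolding v7 by (simp add: field_simps)
  have C: "x * (N * N' / (2 * (v * q) * r)) * (- (8 * M) * (r^7 / (2 * v^6))) =
      2 * (x * - (r^6 * N * N' * (M / (v^7 * q))))" for x N N'
    using pos unfolding v7 r7 by (simp add: field_simps)
  show ?thesis
    unfolding xcf_ode_def v_def[symmetric] sec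
    using sol_pos[OF u, folded v_def]
    by (intro conjI DERIV_cong[OF d(1) A] DERIV_cong[OF d(2) B] DERIV_cong[OF d(3) C])
qed

end

section \<open>Solving the scalar equation by inverting the lifetime\<close>

lemma lifetime_surj:
  assumes "0 < u0" "u0 < 1" "0 < y" "y \<le> lifetime u0"
  shows "\<exists>u. 0 < u \<and> u < 1 \<and> lifetime u = y"
proof -
  obtain u where u: "0 \<le> u" "u \<le> u0" "lifetime u = y"
    using IVT'[of lifetime 0 y u0] lifetime_continuous[OF assms(2)] assms by auto
  then have "u \<noteq> 0"
    using assms(3) by auto
  then show ?thesis
    using u assms by (intro exI[of _ u]) auto
qed

text \<open>Separation of variables: u' = -l (1 - u^2)^7/(2u^6) says that \<open>lifetime u\<close>
  decreases at the constant rate \<open>l\<close>.\<close>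

definition trajectory :: "real \<Rightarrow> real \<Rightarrow> real \<Rightarrow> real" where
  "trajectory l u0 t = the_inv_into {0<..<1} lifetime (lifetime u0 - l * t)"

text \<open>Before the final time the prescribed lifetime is positive and at most its initial value,
  so it is attained in (0, 1). The derivative comes from the inverse function theorem, since
  \<open>lifetime\<close> has nonzero derivative there.\<close>

lemma trajectory:
  assumes "0 < u0" "u0 < 1" "0 < l" and t: "0 \<le> t" "t < lifetime u0 / l"
  shows "0 < trajectory l u0 t" "trajectory l u0 t < 1"
    and "lifetime (trajectory l u0 t) = lifetime u0 - l * t"
    and "(trajectory l u0 has_real_derivative
      - l * ((1 - (trajectory l u0 t)\<^sup>2)^7 / (2 * (trajectory l u0 t)^6))) (at t within {0..})"
proof -
  have "0 < lifetime u0 - l * t" "lifetime u0 - l * t \<le> lifetime u0"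
    using assms by (simp_all add: field_simps)
  then obtain u where u: "0 < u" "u < 1" "lifetime u = lifetime u0 - l * t"
    using lifetime_surj[OF assms(1,2)] by blast
  let ?I = "the_inv_into {0<..<1} lifetime"
  have I: "?I (lifetime v) = v" if "v \<in> {0<..<1}" for v
    using lifetime_inj that by (rule the_inv_into_f_f)
  have uI: "trajectory l u0 t = u"
    using u I[of u] by (simp add: trajectory_def flip: u(3))
  show "0 < trajectory l u0 t" "trajectory l u0 t < 1"
    "lifetime (trajectory l u0 t) = lifetime u0 - l * t"
    by (simp_all add: uI u)
  have c: "continuous_on {0<..<1} lifetime"
    by (rule DERIV_continuous_on) (auto intro: has_field_derivative_at_within lifetime_derivative)
  have D: "2 * u^6 / (1 - u\<^sup>2)^7 \<noteq> 0"
    using u one_minus_square_pos[of u] by simp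
  have "(?I has_derivative (*) (inverse (2 * u^6 / (1 - u\<^sup>2)^7))) (at (lifetime u))"
    by (rule has_derivative_inverse_strong[OF _ _ c I
          lifetime_derivative[OF u(1,2), unfolded has_field_derivative_def]])
      (use u D in \<open>auto simp: fun_eq_iff\<close>)
  then have "(?I has_real_derivative inverse (2 * u^6 / (1 - u\<^sup>2)^7)) (at (lifetime u0 - l * t))"
    by (simp add: has_field_derivative_def u(3))
  then have "((\<lambda>t. ?I (lifetime u0 - l * t)) has_real_derivative
      inverse (2 * u^6 / (1 - u\<^sup>2)^7) * (- l)) (at t within {0..})"
    by (rule DERIV_chain2) (auto intro!: derivative_eq_intros)
  then show "(trajectory l u0 has_real_derivative
      - l * ((1 - (trajectory l u0 t)\<^sup>2)^7 / (2 * (trajectory l u0 t)^6))) (at t within {0..})"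
    unfolding uI by (simp add: trajectory_def[abs_def] mult.commute)
qed

section \<open>Blow-up time and asymptotics\<close>

text \<open>This is the uniqueness argument: the conserved quantities express any solution through
  u, and the lifetime of u is an explicit affine function of time. As \<open>lifetime\<close> is
  injective on (0, 1), nothing is left free.\<close>

lemma ode_implies_sol:
  fixes A B C :: "real \<Rightarrow> real" and S :: ereal
  assumes ode: "\<And>t. \<lbrakk>0 \<le> t; ereal t < S\<rbrakk> \<Longrightarrow> xcf_ode A B C t"
    and less: "B 0 < A 0" and t: "0 \<le> t" "ereal t < S"
  defines "n \<equiv> sqrt (A 0 * B 0 * (A 0 + B 0)\<^sup>2)"
    and "K \<equiv> (C 0)\<^sup>2 * (A 0 - B 0)^4 / (A 0 * B 0)"
    and "u \<equiv> \<lambda>t. sqrt (B t / A t)"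
  shows "0 < u t" "u t < 1"
    and "A t = sol_A n (u t)" "B t = sol_B n (u t)" "C t = sol_C n K (u t)"
    and "lifetime (u t) = lifetime (u 0) - 8 * n / K * t"
proof -
  have "ereal 0 < S"
    using t by (metis ereal_less_eq(3) order.strict_trans1)
  from ode[OF order_refl this] have pos0: "A 0 > 0" "B 0 > 0" "C 0 > 0"
    by (auto simp: xcf_ode_def)
  have nK: "n > 0" "K > 0"
    using pos0 less by (simp_all add: n_def K_def add_pos_pos)
  have n2: "n\<^sup>2 = A 0 * B 0 * (A 0 + B 0)\<^sup>2"
    using pos0 by (simp add: n_def)
  have sol: "0 < u s" "u s < 1" "A s = sol_A n (u s)" "B s = sol_B n (u s)" "C s = sol_C n K (u s)"
    and pos: "A s > 0" "B s > 0" if s: "0 \<le> s" "ereal s < S" for s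
  proof -
    show pos: "A s > 0" "B s > 0"
      using ode[OF s] by (simp_all add: xcf_ode_def)
    have "C s > 0"
      using ode[OF s] by (simp add: xcf_ode_def)
    note * = sol_unique[OF pos(2) ode_less[OF ode less s] this, of n K]
    have "A s * B s * (A s + B s)\<^sup>2 = n\<^sup>2"
      unfolding n2 by (rule conserved_fourth_power[OF ode s])
    moreover have "(C s)\<^sup>2 * (A s - B s)^4 / (A s * B s) = K"
      unfolding K_def by (rule conserved_ratio[OF ode s])
    ultimately show "0 < u s" "u s < 1" "A s = sol_A n (u s)" "B s = sol_B n (u s)"
      "C s = sol_C n K (u s)"
      using * nK(1) by (simp_all add: u_def)
  qed
  show "0 < u t" "u t < 1" "A t = sol_A n (u t)" "B t = sol_B n (u t)" "C t = sol_C n K (u t)"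
    using sol[OF t] by simp_all
  have "((\<lambda>t. lifetime (u t) + 8 * n / K * t) has_real_derivative 0) (at s within {0..})"
    if s: "0 \<le> s" "ereal s < S" for s
  proof -
    define a b c k1 k2 k3 v where "a = A s" and "b = B s" and "c = C s"
      and "k1 = sec1 a b c" and "k2 = sec2 a b c" and "k3 = sec3 a b c" and "v = u s"
    note defs = a_def b_def c_def k1_def k2_def k3_def
    have d: "(A has_real_derivative 2 * (a * (k2 * k3))) (at s within {0..})"
      "(B has_real_derivative 2 * (b * (k1 * k3))) (at s within {0..})"
      using ode[OF s] by (auto simp: xcf_ode_def defs)
    have ab: "a > 0" "b > 0"
      using pos[OF s] by (simp_all add: a_def b_def)
    have v: "v > 0" "v < 1" "sqrt (b / a) = v"
      using sol(1,2)[OF s] by (simp_all add: v_def u_def a_def b_def)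
    have "((\<lambda>t. B t / A t) has_real_derivative b / a * (2 * (k1 * k3 - k2 * k3)))
        (at s within {0..})"
      using ab by (auto intro!: derivative_eq_intros d simp flip: a_def b_def) (simp add: field_simps)
    then have "((\<lambda>t. sqrt (B t / A t)) has_real_derivative
        inverse (sqrt (B s / A s)) / 2 * (b / a * (2 * (k1 * k3 - k2 * k3)))) (at s within {0..})"
      by (rule DERIV_chain2[OF DERIV_real_sqrt, rotated]) (use ab in \<open>simp add: a_def b_def\<close>)
    also have "inverse (sqrt (B s / A s)) / 2 * (b / a * (2 * (k1 * k3 - k2 * k3))) =
        v * (k1 * k3 - k2 * k3)"
    proof -
      have "b / a = v * v"
        using ab unfolding v(3)[symmetric] by simp
      then show ?thesis
        using v by (simp add: field_simps flip: a_def b_def)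
    qed
    finally have du: "(u has_real_derivative v * (k1 * k3 - k2 * k3)) (at s within {0..})"
      by (simp add: u_def)
    define r q where "r = 1 - v\<^sup>2" and "q = 1 + v\<^sup>2"
    have rq: "r > 0" "q > 0"
      using one_minus_square_pos[of v] v by (simp_all add: r_def q_def add_pos_nonneg)
    \<comment> \<open>The numerators 3 + v^2 and 1 + 3v^2 add up to 4(1 + v^2), which cancels
      \<open>q\<close>. Together with the 2 in the derivative of \<open>lifetime\<close> this
      produces the rate 8n/K.\<close>
    have "k1 * k3 - k2 * k3 = - (4 * r^7 * q * (n / (K * v^7 * q)))"
      unfolding defs sol(3-5)[OF s] sol_sec[OF nK sol(1,2)[OF s]]
      unfolding v_def[symmetric] r_def[symmetric] q_def[symmetric]
      by (simp add: q_def algebra_simps)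
    also have "\<dots> = - (4 * r^7 * (n / (K * v^7)))"
      using rq by simp
    finally have k: "k1 * k3 - k2 * k3 = - (4 * r^7 * (n / (K * v^7)))" .
    have "((\<lambda>t. lifetime (u t)) has_real_derivative
        2 * (u s)^6 / (1 - (u s)\<^sup>2)^7 * (v * (k1 * k3 - k2 * k3))) (at s within {0..})"
      by (rule DERIV_chain2[OF lifetime_derivative du]) (use sol[OF s] in auto)
    also have "2 * (u s)^6 / (1 - (u s)\<^sup>2)^7 * (v * (k1 * k3 - k2 * k3)) = - (8 * n / K)"
      unfolding k v_def[symmetric] r_def[symmetric]
      using rq v nK by (simp add: field_simps eval_nat_numeral)
    finally show ?thesis
      using nK by (auto intro!: derivative_eq_intros)
  qed
  from constant_if_derivative_zero[OF this t]
  show "lifetime (u t) = lifetime (u 0) - 8 * n / K * t"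
    by simp
qed

lemma pxcf_solution_sol:
  assumes "n > 0" "K > 0" "0 < u0" "u0 < 1"
  defines "u \<equiv> trajectory (8 * n / K) u0"
  shows "pxcf_solution (ereal (lifetime u0 / (8 * n / K)))
    (\<lambda>t. diag_metric (sol_A n (u t)) (sol_B n (u t)) (sol_C n K (u t)))"
proof -
  have l: "8 * n / K > 0"
    using assms by simp
  have "ereal (lifetime u0 / (8 * n / K)) > 0"
    using divide_pos_pos[OF lifetime_pos[OF assms(3,4)] l] by (simp only: ereal_less)
  moreover have "xcf_ode (\<lambda>t. sol_A n (u t)) (\<lambda>t. sol_B n (u t)) (\<lambda>t. sol_C n K (u t)) t"
    if "0 \<le> t" "ereal t < ereal (lifetime u0 / (8 * n / K))" for t
    unfolding u_def
    using that by (intro sol_ode assms trajectory l) (simp_all only: ereal_less_eq less_ereal.simps)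
  ultimately show ?thesis
    unfolding pxcf_solution_diag_iff by blast
qed

section \<open>Limits and asymptotics at the final time\<close>

context
  fixes u :: "real \<Rightarrow> real" and l T :: real
  assumes lT: "l > 0" "T > 0"
    and u: "\<And>t. \<lbrakk>0 < t; t < T\<rbrakk> \<Longrightarrow> 0 < u t \<and> u t < 1 \<and> lifetime (u t) = l * (T - t)"
begin

lemma eventually_left: "eventually (\<lambda>t. 0 < t \<and> t < T) (at_left T)"
  using eventually_at_left_real[OF lT(2)] by simp

text \<open>The lower bound on \<open>lifetime\<close> gives u^7 \<le> (7/2) l (T - t), and u is
  squeezed to 0.\<close>

lemma ratio_tendsto_0: "(u \<longlongrightarrow> 0) (at_left T)"
proof -
  have "((\<lambda>t. root 7 (7 / 2 * (l * (T - t)))) \<longlongrightarrow> root 7 (7 / 2 * (l * (T - T)))) (at_left T)"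
    by (intro tendsto_intros)
  then have "((\<lambda>t. root 7 (7 / 2 * (l * (T - t)))) \<longlongrightarrow> 0) (at_left T)"
    by simp
  moreover have "eventually (\<lambda>t. 0 \<le> u t) (at_left T)"
    using eventually_left by eventually_elim (use u in force)
  moreover have "eventually (\<lambda>t. u t \<le> root 7 (7 / 2 * (l * (T - t)))) (at_left T)"
    using eventually_left
  proof eventually_elim
    case (elim t)
    with u[of t] have "u t ^ 7 \<le> 7 / 2 * (l * (T - t))"
      using lifetime_bounds(1)[of "u t"] by simp
    then have "root 7 (u t ^ 7) \<le> root 7 (7 / 2 * (l * (T - t)))"
      by (simp only: real_root_le_iff)
    moreover have "root 7 (u t ^ 7) = u t"
      using u[of t] elim by (intro real_root_power_cancel) auto
    ultimately show ?case
      by (simp only:)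
  qed
  ultimately show ?thesis
    by (rule tendsto_sandwich[OF _ _ tendsto_const, rotated 2])
qed

text \<open>The two bounds on \<open>lifetime\<close> enclose u^7/(T - t) between (7/2) l (1 -
  u^2)^7 and (7/2) l. As u tends to 0 both ends have the same limit, and taking seventh roots
  finishes the argument.\<close>

lemma ratio_asymp:
  "u \<sim>[at_left T] (\<lambda>t. (7 / 2 * l) powr (1 / 7) * (T - t) powr (1 / 7))"
proof -
  have "((\<lambda>t. 7 / 2 * l * (1 - (u t)\<^sup>2)^7) \<longlongrightarrow> 7 / 2 * l * (1 - 0\<^sup>2)^7) (at_left T)"
    by (intro tendsto_intros ratio_tendsto_0)
  then have "((\<lambda>t. 7 / 2 * l * (1 - (u t)\<^sup>2)^7) \<longlongrightarrow> 7 / 2 * l) (at_left T)"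
    by simp
  moreover have "eventually (\<lambda>t. 7 / 2 * l * (1 - (u t)\<^sup>2)^7 \<le> u t ^ 7 / (T - t)) (at_left T)"
    using eventually_left
  proof eventually_elim
    case (elim t)
    define w where "w = (1 - (u t)\<^sup>2)^7"
    have "w > 0"
      using one_minus_square_pos[of "u t"] u[of t] elim by (simp add: w_def)
    moreover have "l * (T - t) \<le> 2 / 7 * u t ^ 7 / w"
      using lifetime_bounds(2)[of "u t"] u[of t] elim by (simp add: w_def)
    ultimately show ?case
      using elim by (simp add: field_simps flip: w_def)
  qed
  moreover have "eventually (\<lambda>t. u t ^ 7 / (T - t) \<le> 7 / 2 * l) (at_left T)"
    using eventually_left
  proof eventually_elim
    case (elim t)
    then show ?case
      using lifetime_bounds(1)[of "u t"] u[of t] by (simp add: field_simps)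
  qed
  ultimately have "((\<lambda>t. u t ^ 7 / (T - t)) \<longlongrightarrow> 7 / 2 * l) (at_left T)"
    by (rule tendsto_sandwich[OF _ _ _ tendsto_const, rotated 2])
  then have "(\<lambda>t. u t ^ 7) \<sim>[at_left T] (\<lambda>t. 7 / 2 * l * (T - t))"
    by (rule asymp_equivI'_const) (use lT in simp)
  then have "(\<lambda>t. (u t ^ 7) powr (1 / 7)) \<sim>[at_left T] (\<lambda>t. (7 / 2 * l * (T - t)) powr (1 / 7))"
  proof (rule asymp_equiv_powr_real)
    show "eventually (\<lambda>t. u t ^ 7 \<ge> 0) (at_left T)"
      using eventually_left by eventually_elim (use u in force)
    show "eventually (\<lambda>t. 7 / 2 * l * (T - t) \<ge> 0) (at_left T)"
      using eventually_left by eventually_elim (use lT in simp)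
  qed
  also have "(\<lambda>t. (7 / 2 * l * (T - t)) powr (1 / 7)) \<sim>[at_left T]
      (\<lambda>t. (7 / 2 * l) powr (1 / 7) * (T - t) powr (1 / 7))"
    by (rule asymp_equiv_refl_ev, rule eventually_mono[OF eventually_left], rule powr_mult)
  finally have *: "(\<lambda>t. (u t ^ 7) powr (1 / 7)) \<sim>[at_left T]
      (\<lambda>t. (7 / 2 * l) powr (1 / 7) * (T - t) powr (1 / 7))" .
  have "u \<sim>[at_left T] (\<lambda>t. (u t ^ 7) powr (1 / 7))"
  proof (rule asymp_equiv_refl_ev, rule eventually_mono[OF eventually_left])
    fix t assume "0 < t \<and> t < T"
    with u[of t] have "0 < u t" "u t ^ 7 = u t powr 7"
      by simp_all
    then show "u t = (u t ^ 7) powr (1 / 7)"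
      by (simp only: powr_powr) simp
  qed
  with * show ?thesis
    by (rule asymp_equiv_trans[rotated])
qed

text \<open>As u behaves like c (T - t)^(1/7) and A like sqrt n u^(-1/2), the exponent of A is
  -1/14. Then B = u^2 A gives 2/7 - 1/14 = 3/14, and C, which behaves like sqrt K u/A, gives 1/7 +
  1/14 = 3/14.\<close>

lemma sol_asymp:
  assumes nK: "n > 0" "K > 0"
  shows "\<exists>\<eta>1 \<eta>2 \<eta>3. \<eta>1 > 0 \<and> \<eta>2 > 0 \<and> \<eta>3 > 0 \<and>
    (\<lambda>t. sol_A n (u t)) \<sim>[at_left T] (\<lambda>t. \<eta>1 * (T - t) powr (- 1 / 14)) \<and>
    (\<lambda>t. sol_B n (u t)) \<sim>[at_left T] (\<lambda>t. \<eta>2 * (T - t) powr (3 / 14)) \<and>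
    (\<lambda>t. sol_C n K (u t)) \<sim>[at_left T] (\<lambda>t. \<eta>3 * (T - t) powr (3 / 14))"
proof -
  define c where "c = (7 / 2 * l) powr (1 / 7)"
  define e where "e = sqrt n * c powr (- 1 / 2)"
  have pos: "c > 0" "e > 0"
    using lT nK by (simp_all add: c_def e_def)
  have asu: "u \<sim>[at_left T] (\<lambda>t. c * (T - t) powr (1 / 7))"
    unfolding c_def by (rule ratio_asymp)
  have "((\<lambda>t. sqrt n / sqrt (1 + (u t)\<^sup>2)) \<longlongrightarrow> sqrt n / sqrt (1 + 0\<^sup>2)) (at_left T)"
    by (intro tendsto_intros ratio_tendsto_0) simp
  then have 1: "(\<lambda>t. sqrt n / sqrt (1 + (u t)\<^sup>2)) \<sim>[at_left T] (\<lambda>_. sqrt n)"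
    using nK by (intro tendsto_imp_asymp_equiv_const) simp_all
  have 2: "(\<lambda>t. u t powr (- 1 / 2)) \<sim>[at_left T] (\<lambda>t. (c * (T - t) powr (1 / 7)) powr (- 1 / 2))"
    using asu
  proof (rule asymp_equiv_powr_real)
    show "eventually (\<lambda>t. u t \<ge> 0) (at_left T)"
      using eventually_left by eventually_elim (use u in force)
  qed (use pos in simp)
  have "(\<lambda>t. sol_A n (u t)) \<sim>[at_left T]
      (\<lambda>t. sqrt n / sqrt (1 + (u t)\<^sup>2) * u t powr (- 1 / 2))"
  proof (rule asymp_equiv_refl_ev, rule eventually_mono[OF eventually_left])
    fix t assume "0 < t \<and> t < T"
    with u[of t] have "u t powr (- 1 / 2) = 1 / sqrt (u t)"
      by (simp add: powr_minus_divide powr_half_sqrt)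
    then show "sol_A n (u t) = sqrt n / sqrt (1 + (u t)\<^sup>2) * u t powr (- 1 / 2)"
      by (simp add: sol_A_def real_sqrt_divide real_sqrt_mult)
  qed
  also note asymp_equiv_mult[OF 1 2]
  also have "(\<lambda>t. sqrt n * (c * (T - t) powr (1 / 7)) powr (- 1 / 2)) \<sim>[at_left T]
      (\<lambda>t. e * (T - t) powr (- 1 / 14))"
    by (rule asymp_equiv_refl_ev, rule eventually_mono[OF eventually_left])
      (use pos in \<open>simp add: e_def powr_mult powr_powr\<close>)
  finally have A: "(\<lambda>t. sol_A n (u t)) \<sim>[at_left T] (\<lambda>t. e * (T - t) powr (- 1 / 14))" .
  have "(\<lambda>t. sol_B n (u t)) \<sim>[at_left T]
      (\<lambda>t. (c * (T - t) powr (1 / 7))^2 * (e * (T - t) powr (- 1 / 14)))"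
    unfolding sol_B_def by (intro asymp_equiv_intros asu A)
  also have "\<dots> \<sim>[at_left T] (\<lambda>t. c\<^sup>2 * e * (T - t) powr (3 / 14))"
  proof (rule asymp_equiv_refl_ev, rule eventually_mono[OF eventually_left])
    fix t assume "0 < t \<and> t < T"
    then have "((T - t) powr (1 / 7))\<^sup>2 * (T - t) powr (- 1 / 14) = (T - t) powr (3 / 14)"
      by (simp add: power2_eq_square flip: powr_add)
    then show "(c * (T - t) powr (1 / 7))^2 * (e * (T - t) powr (- 1 / 14)) =
        c\<^sup>2 * e * (T - t) powr (3 / 14)"
      by (simp add: power_mult_distrib mult_ac)
  qed
  finally have B: "(\<lambda>t. sol_B n (u t)) \<sim>[at_left T] (\<lambda>t. c\<^sup>2 * e * (T - t) powr (3 / 14))" .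
  have "((\<lambda>t. (1 - (u t)\<^sup>2)\<^sup>2) \<longlongrightarrow> (1 - 0\<^sup>2)\<^sup>2) (at_left T)"
    by (intro tendsto_intros ratio_tendsto_0)
  then have 3: "(\<lambda>t. (1 - (u t)\<^sup>2)\<^sup>2) \<sim>[at_left T] (\<lambda>_. 1)"
    by (intro tendsto_imp_asymp_equiv_const) simp_all
  have "(\<lambda>t. sol_C n K (u t)) \<sim>[at_left T]
      (\<lambda>t. sqrt K * (c * (T - t) powr (1 / 7)) / (e * (T - t) powr (- 1 / 14) * 1))"
    unfolding sol_C_def by (intro asymp_equiv_intros asu A 3)
  also have "\<dots> \<sim>[at_left T] (\<lambda>t. sqrt K * c / e * (T - t) powr (3 / 14))"
  proof (rule asymp_equiv_refl_ev, rule eventually_mono[OF eventually_left])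
    fix t assume "0 < t \<and> t < T"
    then have *: "(T - t) powr (1 / 7) / (T - t) powr (- 1 / 14) = (T - t) powr (3 / 14)"
      by (simp flip: powr_diff)
    show "sqrt K * (c * (T - t) powr (1 / 7)) / (e * (T - t) powr (- 1 / 14) * 1) =
        sqrt K * c / e * (T - t) powr (3 / 14)"
      unfolding *[symmetric] by simp
  qed
  finally have C: "(\<lambda>t. sol_C n K (u t)) \<sim>[at_left T]
      (\<lambda>t. sqrt K * c / e * (T - t) powr (3 / 14))" .
  show ?thesis
    using A B C pos nK by (intro exI[of _ e] exI[of _ "c\<^sup>2 * e"] exI[of _ "sqrt K * c / e"]) simp
qed

text \<open>Since A^2 u (1 + u^2) = n throughout while u tends to 0, a finite limit of A would force
  n = 0. This is what rules out continuing the solution past \<open>T\<close>.\<close>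

lemma sol_A_no_limit:
  assumes n: "n > 0"
  shows "\<not> ((\<lambda>t. sol_A n (u t)) \<longlongrightarrow> L) (at_left T)"
proof
  assume "((\<lambda>t. sol_A n (u t)) \<longlongrightarrow> L) (at_left T)"
  then have "((\<lambda>t. (sol_A n (u t))\<^sup>2 * (u t * (1 + (u t)\<^sup>2))) \<longlongrightarrow> L\<^sup>2 * (0 * (1 + 0\<^sup>2))) (at_left T)"
    by (intro tendsto_intros ratio_tendsto_0)
  moreover have "((\<lambda>t. (sol_A n (u t))\<^sup>2 * (u t * (1 + (u t)\<^sup>2))) \<longlongrightarrow> n) (at_left T)"
    by (rule tendsto_eventually, rule eventually_mono[OF eventually_left])
      \<comment> \<open>The \<open>1\<close> instantiates the parameter \<open>K\<close> of
        \<open>sol_A_square\<close> by an arbitrary positive number.\<close>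
      (use u n in \<open>simp add: sol_A_square[of _ 1]\<close>)
  ultimately show False
    using n tendsto_unique[OF trivial_limit_at_left_real] by fastforce
qed

end

section \<open>Maximal solutions in the two cases\<close>

theorem theorem5p4:
  fixes A0 B0 C0 :: real
  assumes "A0 > 0" and "B0 > 0" and "C0 > 0"
  shows
    "(A0 = B0 \<longrightarrow>
       (\<exists>T A B C. diag_pxcf_from A0 B0 C0 T A B C) \<and>
       (\<forall>T A B C. diag_pxcf_from A0 B0 C0 T A B C \<longrightarrow>
          T = \<infinity> \<and>
          (\<forall>t\<ge>0. diag_metric (A t) (B t) (C t) = diag_metric A0 A0 C0))) \<and>
     (A0 > B0 \<longrightarrow>
       (\<exists>T::real. T > 0 \<and>
          (\<exists>A B C. diag_pxcf_from A0 B0 C0 (ereal T) A B C) \<and>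
          (\<forall>S A B C. diag_pxcf_from A0 B0 C0 S A B C \<longrightarrow>
             S = ereal T \<and>
             (\<exists>\<eta>1 \<eta>2 \<eta>3 :: real. \<eta>1 > 0 \<and> \<eta>2 > 0 \<and> \<eta>3 > 0 \<and>
                A \<sim>[at_left T] (\<lambda>t. \<eta>1 * (T - t) powr (- 1 / 14)) \<and>
                B \<sim>[at_left T] (\<lambda>t. \<eta>2 * (T - t) powr (3 / 14)) \<and>
                C \<sim>[at_left T] (\<lambda>t. \<eta>3 * (T - t) powr (3 / 14))))))"
proof (intro conjI impI)
  assume eq: "A0 = B0"
  have const: "pxcf_solution \<infinity> (\<lambda>t. diag_metric A0 A0 C0)"
    unfolding pxcf_solution_diag_iff[of _ "\<lambda>_. A0" "\<lambda>_. A0" "\<lambda>_. C0"] using assms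
    by (simp add: xcf_ode_def sec1_def sec2_def sec3_def)
  then have "diag_pxcf_from A0 B0 C0 \<infinity> (\<lambda>_. A0) (\<lambda>_. A0) (\<lambda>_. C0)"
    by (simp add: diag_pxcf_from_def pxcf_maximal_solution_def eq)
  then show "\<exists>T A B C. diag_pxcf_from A0 B0 C0 T A B C"
    by blast
  show "\<forall>T A B C. diag_pxcf_from A0 B0 C0 T A B C \<longrightarrow>
      T = \<infinity> \<and> (\<forall>t\<ge>0. diag_metric (A t) (B t) (C t) = diag_metric A0 A0 C0)"
  proof (intro allI impI)
    fix T A B C
    assume "diag_pxcf_from A0 B0 C0 T A B C"
    then have init: "A 0 = A0" "B 0 = B0" "C 0 = C0"
      and sol: "pxcf_solution T (\<lambda>t. diag_metric (A t) (B t) (C t))"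
      and max: "\<not> (\<exists>S g'. S > T \<and> pxcf_solution S g' \<and>
        (\<forall>t\<ge>0. ereal t < T \<longrightarrow> g' t = diag_metric (A t) (B t) (C t)))"
      by (auto simp: diag_pxcf_from_def pxcf_maximal_solution_def)
    have ode: "\<And>t. \<lbrakk>0 \<le> t; ereal t < T\<rbrakk> \<Longrightarrow> xcf_ode A B C t"
      using sol by (simp add: pxcf_solution_diag_iff)
    have *: "diag_metric (A t) (B t) (C t) = diag_metric A0 A0 C0" if "0 \<le> t" "ereal t < T" for t
      using ode_constant_if_eq[OF ode _ that] init eq by simp
    \<comment> \<open>On a finite interval the solution would be extended by the constant one,
      against maximality.\<close>
    have "T = \<infinity>"
    proof (rule ccontr)
      assume "T \<noteq> \<infinity>"
      then have "T < \<infinity>"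
        by simp
      with max const * show False
        by metis
    qed
    with * show "T = \<infinity> \<and> (\<forall>t\<ge>0. diag_metric (A t) (B t) (C t) = diag_metric A0 A0 C0)"
      by simp
  qed
next
  assume less: "A0 > B0"
  define n where "n = sqrt (A0 * B0 * (A0 + B0)\<^sup>2)"
  define K where "K = C0\<^sup>2 * (A0 - B0)^4 / (A0 * B0)"
  define u0 where "u0 = sqrt (B0 / A0)"
  define l where "l = 8 * n / K"
  define T where "T = lifetime u0 / l"
  define u where "u = trajectory l u0"
  define g where "g t = diag_metric (sol_A n (u t)) (sol_B n (u t)) (sol_C n K (u t))" for t
  have nK: "n > 0" "K > 0"
    using assms less by (simp_all add: n_def K_def add_pos_pos)
  have u0: "0 < u0" "u0 < 1" and init: "A0 = sol_A n u0" "B0 = sol_B n u0" "C0 = sol_C n K u0"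
    using sol_unique[OF assms(2) less assms(3), of n K] nK assms
    by (simp_all add: n_def K_def u0_def)
  have l: "l > 0"
    using nK by (simp add: l_def)
  have T: "T > 0"
    unfolding T_def using lifetime_pos[OF u0] l by simp
  have traj: "0 < u t" "u t < 1" "lifetime (u t) = lifetime u0 - l * t" if "0 \<le> t" "t < T" for t
    using trajectory[OF u0 l] that by (simp_all add: u_def T_def)
  have trajectory_eq: "u t = v" if "0 \<le> t" "t < T" "0 < v" "v < 1" "lifetime v = lifetime u0 - l * t" for t v
    using inj_onD[OF lifetime_inj, of "u t" v] traj[OF that(1,2)] that by simp
  have lifetime_T: "lifetime u0 = l * T"
    using l by (simp add: T_def)
  have u_left: "0 < u t \<and> u t < 1 \<and> lifetime (u t) = l * (T - t)" if "0 < t" "t < T" for t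
    using traj[of t] that by (simp add: lifetime_T algebra_simps)
  have sol: "pxcf_solution (ereal T) g"
    unfolding g_def[abs_def] u_def T_def l_def by (rule pxcf_solution_sol[OF nK u0])
  \<comment> \<open>A competing extension \<open>g'\<close> need not be diagonal, so it is tested on
    the first frame vector only. That entry would be differentiable at \<open>T\<close>, hence
    continuous, yet to the left of \<open>T\<close> it equals \<open>sol_A n (u t)\<close>, which
    has no finite limit.\<close>
  have max: "\<not> (\<exists>S g'. S > ereal T \<and> pxcf_solution S g' \<and> (\<forall>t\<ge>0. ereal t < ereal T \<longrightarrow> g' t = g t))"
  proof
    assume "\<exists>S g'. S > ereal T \<and> pxcf_solution S g' \<and> (\<forall>t\<ge>0. ereal t < ereal T \<longrightarrow> g' t = g t)"
    then obtain S g' where S: "S > ereal T" "pxcf_solution S g'"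
      and g': "\<And>t. \<lbrakk>0 \<le> t; t < T\<rbrakk> \<Longrightarrow> g' t = g t"
      by auto
    let ?a = "\<lambda>t. g' t (axis 1 1) (axis 1 1)"
    have "\<exists>h. is_cross_curvature (g' T) h \<and>
        (\<forall>u v. ((\<lambda>s. g' s u v) has_real_derivative 2 * h u v) (at T within {0..}))"
      using S(2)[unfolded pxcf_solution_def, THEN conjunct2, rule_format, OF less_imp_le[OF T] S(1)]
      by (rule conjunct2)
    then obtain h where h: "\<forall>u v. ((\<lambda>s. g' s u v) has_real_derivative 2 * h u v) (at T within {0..})"
      by (elim exE conjE) (rule that)
    define D where "D = 2 * h (axis 1 1) (axis 1 1)"
    have "(?a has_real_derivative D) (at T within {0..})"
      unfolding D_def by (rule h[THEN spec, THEN spec])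
    moreover have "at T within {0..} = at T"
      by (rule at_within_open_subset[of _ "{0<..}"]) (use T in auto)
    ultimately have "isCont ?a T"
      by (metis DERIV_isCont)
    then have "(?a \<longlongrightarrow> ?a T) (at_left T)"
      unfolding isCont_def filterlim_at_split by (rule conjunct1)
    moreover have "eventually (\<lambda>t. ?a t = sol_A n (u t)) (at_left T)"
      using eventually_at_left_real[OF T]
      by eventually_elim (simp add: g' g_def diag_metric_def axis_def)
    ultimately have "((\<lambda>t. sol_A n (u t)) \<longlongrightarrow> ?a T) (at_left T)"
      by (rule Lim_transform_eventually)
    then show False
      using sol_A_no_limit[OF l T u_left nK(1)] by blast
  qed
  have "u 0 = u0"
    using trajectory_eq[of 0 u0] T u0 by simp
  then have "diag_pxcf_from A0 B0 C0 (ereal T)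
      (\<lambda>t. sol_A n (u t)) (\<lambda>t. sol_B n (u t)) (\<lambda>t. sol_C n K (u t))"
    using sol max by (simp add: diag_pxcf_from_def pxcf_maximal_solution_def g_def[abs_def] flip: init)
  moreover have "S = ereal T \<and>
      (\<exists>\<eta>1 \<eta>2 \<eta>3 :: real. \<eta>1 > 0 \<and> \<eta>2 > 0 \<and> \<eta>3 > 0 \<and>
        A \<sim>[at_left T] (\<lambda>t. \<eta>1 * (T - t) powr (- 1 / 14)) \<and>
        B \<sim>[at_left T] (\<lambda>t. \<eta>2 * (T - t) powr (3 / 14)) \<and>
        C \<sim>[at_left T] (\<lambda>t. \<eta>3 * (T - t) powr (3 / 14)))"
    if "diag_pxcf_from A0 B0 C0 S A B C" for S A B C
  proof
    from that have init': "A 0 = A0" "B 0 = B0" "C 0 = C0"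
      and sol': "pxcf_solution S (\<lambda>t. diag_metric (A t) (B t) (C t))"
      and max': "\<not> (\<exists>R g'. R > S \<and> pxcf_solution R g' \<and>
        (\<forall>t\<ge>0. ereal t < S \<longrightarrow> g' t = diag_metric (A t) (B t) (C t)))"
      by (auto simp: diag_pxcf_from_def pxcf_maximal_solution_def)
    have ode: "\<And>t. \<lbrakk>0 \<le> t; ereal t < S\<rbrakk> \<Longrightarrow> xcf_ode A B C t"
      using sol' by (simp add: pxcf_solution_diag_iff)
    have "B 0 < A 0"
      using less init' by simp
    note S_sol = ode_implies_sol[OF ode this, unfolded init', folded n_def K_def, folded l_def u0_def]
    have before: "t < T" if t: "0 \<le> t" "ereal t < S" for t
    proof -
      have "lifetime (sqrt (B t / A t)) > 0"
        using S_sol(1,2)[OF _ _ t] by (intro lifetime_pos) auto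
      then have "l * t < l * T"
        using S_sol(6)[OF _ _ t] lifetime_T by simp
      then show ?thesis
        using l by simp
    qed
    have agree: "A t = sol_A n (u t)" "B t = sol_B n (u t)" "C t = sol_C n K (u t)"
      if t: "0 \<le> t" "ereal t < S" for t
    proof -
      have "u t = sqrt (B t / A t)"
        using S_sol(1,2,6)[OF _ _ t] before[OF t] t(1) by (intro trajectory_eq) auto
      then show "A t = sol_A n (u t)" "B t = sol_B n (u t)" "C t = sol_C n K (u t)"
        using S_sol(3-5)[OF _ _ t] by simp_all
    qed
    \<comment> \<open>If \<open>S\<close> exceeded \<open>T\<close>, then \<open>before\<close>
      would apply at time \<open>T\<close> itself. If \<open>S\<close> were smaller,
      \<open>g\<close> would extend the given solution and contradict its maximality.\<close>
    show S: "S = ereal T"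
    proof (rule antisym)
      show "S \<le> ereal T"
        using before[of T] T by (meson less_imp_le less_irrefl not_le)
      show "ereal T \<le> S"
      proof (rule ccontr)
        assume "\<not> ereal T \<le> S"
        then have "S < ereal T"
          by simp
        moreover have "g t = diag_metric (A t) (B t) (C t)" if "0 \<le> t" "ereal t < S" for t
          using agree[OF that] by (simp add: g_def)
        ultimately show False
          using sol max' by blast
      qed
    qed
    have ev: "eventually (\<lambda>t. sol_A n (u t) = A t) (at_left T)"
      "eventually (\<lambda>t. sol_B n (u t) = B t) (at_left T)"
      "eventually (\<lambda>t. sol_C n K (u t) = C t) (at_left T)"
      using eventually_at_left_real[OF T] by (eventually_elim; use agree S in simp)+
    from sol_asymp[OF l T u_left nK]
    show "\<exists>\<eta>1 \<eta>2 \<eta>3 :: real. \<eta>1 > 0 \<and> \<eta>2 > 0 \<and> \<eta>3 > 0 \<and>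
        A \<sim>[at_left T] (\<lambda>t. \<eta>1 * (T - t) powr (- 1 / 14)) \<and>
        B \<sim>[at_left T] (\<lambda>t. \<eta>2 * (T - t) powr (3 / 14)) \<and>
        C \<sim>[at_left T] (\<lambda>t. \<eta>3 * (T - t) powr (3 / 14))"
      by (simp only: asymp_equiv_cong[OF ev(1) always_eventually[OF allI[OF refl]]]
          asymp_equiv_cong[OF ev(2) always_eventually[OF allI[OF refl]]]
          asymp_equiv_cong[OF ev(3) always_eventually[OF allI[OF refl]]])
  qed
  ultimately show "\<exists>T::real. T > 0 \<and>
      (\<exists>A B C. diag_pxcf_from A0 B0 C0 (ereal T) A B C) \<and>
      (\<forall>S A B C. diag_pxcf_from A0 B0 C0 S A B C \<longrightarrow> S = ereal T \<and>
        (\<exists>\<eta>1 \<eta>2 \<eta>3 :: real. \<eta>1 > 0 \<and> \<eta>2 > 0 \<and> \<eta>3 > 0 \<and>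
          A \<sim>[at_left T] (\<lambda>t. \<eta>1 * (T - t) powr (- 1 / 14)) \<and>
          B \<sim>[at_left T] (\<lambda>t. \<eta>2 * (T - t) powr (3 / 14)) \<and>
          C \<sim>[at_left T] (\<lambda>t. \<eta>3 * (T - t) powr (3 / 14))))"
    using T by (intro exI[of _ T]) blast
qed

end
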